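(* Let $A_1,\dots,A_n$ be events in a probability space $(\Omega,\mathcal F,\mathbf P)$, let $r,d$ be integers with $1\le r\le n$ and $0\le d\le r$, and let $P_r$, $p_r$, $J_d$ and $\mathbf s(j)=(s_1(j),s_2(j),s_3(j))^T$ ($j\in J_d$) be as defined in the context. For an integer $m$ put $\Delta=\Delta(m)=(r-d-m)(r-d-m+1)$ and, when $\Delta\neq 0$, $$\boldsymbol\alpha=\boldsymbol\alpha(m)=\frac{1}{\Delta\,C_r^d}\begin{pmatrix} m(m-1)\\ -2(d+1)(m-1)\\ (d+1)(d+2)\end{pmatrix}.$$ In the inequalities below the parameter $m=m_j$ may be chosen separately for each $j\in J_d$, and "optimal" means minimizing the $j$-th summand of the corresponding upper bound over the admissible values of $m$. (i) If $r-d\ge 2$, then $$P_r\le\sum_{j\in J_d}\boldsymbol\alpha^T\mathbf s(j)\quad\text{and}\quad p_r\le\sum_{j\in J_d}\boldsymbol\alpha^T\mathbf s(j),$$ where $m$ is an arbitrary natural number with $1\le m\le r-d-1$. If $(r-d)s_1(j)-(d+1)s_2(j)>0$, then an admissible $m$ satisfying $$m-1\le (d+1)\frac{(r-d-1)s_2(j)-(d+2)s_3(j)}{(r-d)s_1(j)-(d+1)s_2(j)}\le m \qquad( * )$$ is optimal; if $(r-d)s_1(j)-(d+1)s_2(j)\le 0$, then the optimal value is $1$ or $r-d-1$. (ii) If $r-d\ge 1$ and $n-r\ge 1$, then $$P_r\le\sum_{j\in J_d}\boldsymbol\beta^T\mathbf s(j)\quad\text{and}\quad p_r\le\sum_{j\in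 J_d}\boldsymbol\delta^T\mathbf s(j),$$ where $$\boldsymbol\beta=\frac1{\Delta_1}\begin{pmatrix}0\\ C_n^{d+2}-C_r^{d+2}\\ C_r^{d+1}-C_n^{d+1}\end{pmatrix},\quad \boldsymbol\delta=\frac1{\Delta_1}\begin{pmatrix}0\\ C_n^{d+2}\\ -C_n^{d+1}\end{pmatrix},\quad \Delta_1=C_n^{d+2}C_r^{d+1}-C_n^{d+1}C_r^{d+2}.$$ (iii) If $n-r\ge 2$, then $$P_r\le\sum_{j\in J_d}\boldsymbol\gamma^T\mathbf s(j)\quad\text{and}\quad p_r\le\sum_{j\in J_d}\boldsymbol\alpha^T\mathbf s(j),$$ where $m$ is an arbitrary natural number with $r-d+2\le m\le n-d$, $\boldsymbol\alpha=\boldsymbol\alpha(m)$, and $\boldsymbol\gamma=\boldsymbol\gamma(m)=(\gamma_1,\gamma_2,\gamma_3)^T$ with $$\gamma_1=\frac{m(r-d)(r-d-m)}{C_{m+d-1}^d\Delta}-\frac{(m-1)(r-d)(r-d-m+1)}{C_{m+d}^d\Delta}+\frac{m(m-1)}{C_r^d\Delta},$$ $$\gamma_2=(d+1)\left(-\frac{(r-d-m)(r-d+m-1)}{C_{m+d-1}^d\Delta}+\frac{(r-d-m+1)(r-d+m-2)}{C_{m+d}^d\Delta}-\frac{2(m-1)}{C_r^d\Delta}\right),$$ $$\gamma_3=(d+1)(d+2)\left(\frac{r-d-m}{C_{m+d-1}^d\Delta}-\frac{r-d-m+1}{C_{m+d}^d\Delta}+\frac1{C_r^d\Delta}\right).$$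 If $(r-d)s_1(j)-(d+1)s_2(j)<0$, then an admissible $m$ satisfying $( * )$ is optimal; if $(r-d)s_1(j)-(d+1)s_2(j)\ge 0$, then the optimal value is $r-d+2$ or $n-d$. (iv) If $r-d\ge 2$ and $n-r\ge 2$, then $$P_r\le\sum_{j\in J_d}\min\{\boldsymbol\alpha^T\mathbf s(j),\boldsymbol\beta^T\mathbf s(j),\boldsymbol\gamma^T\mathbf s(j)\}\quad\text{and}\quad p_r\le\sum_{j\in J_d}\min\{\boldsymbol\alpha^T\mathbf s(j),\boldsymbol\delta^T\mathbf s(j)\},$$ where in the bound for $P_r$ the vector $\boldsymbol\alpha=\boldsymbol\alpha(m)$ is taken with any $m\in\{1,\dots,r-d-1\}$ and $\boldsymbol\gamma=\boldsymbol\gamma(m')$ with any $m'\in\{r-d+2,\dots,n-d\}$, and in the bound for $p_r$ the vector $\boldsymbol\alpha=\boldsymbol\alpha(m)$ is taken with any $m\in\{1,\dots,r-d-1\}\cup\{r-d+2,\dots,n-d\}$. (v) Let $\mathcal A\subset\mathcal F$ be a $\sigma$-field. All inequalities for $P_r$ and $p_r$ in (i)--(iv) hold almost surely if $P_r,p_r$ are replaced by $P_r^{\mathcal A},p_r^{\mathcal A}$ and $s_1(j),s_2(j),s_3(j)$ by $s_1^{\mathcal A}(j),s_2^{\mathcal A}(j),s_3^{\mathcal A}(j)$; in this case the optimal $m$ are random variables.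
   Context: $C_u^v=\binom{u}{v}$ is the binomial coefficient, with $C_u^v=0$ for $v>u\ge 0$ and $C_u^0=1$. For events $A_1,\dots,A_n$, $B_i$ is the event that exactly $i$ of them occur ($i=0,\dots,n$) and $U_r=\bigcup_{i=r}^n B_i$ is the event that at least $r$ of them occur. Put $p_i=\mathbf P(B_i)$, $P_r=\mathbf P(U_r)=\sum_{i=r}^n p_i$. For a $\sigma$-field $\mathcal A\subset\mathcal F$, $p_i^{\mathcal A}=\mathbf P(B_i\mid\mathcal A)$ and $P_r^{\mathcal A}=\mathbf P(U_r\mid\mathcal A)$. For $1\le d\le n$, $J_d$ is the set of $j=(j_1,\dots,j_d)\in\mathbb N^d$ with $1\le j_1<\dots<j_d\le n$; $J_0=\{0\}$. For $j\in J_d$ write $A_{j_1}\cdots A_{j_d}$ for the intersection (equal to $\Omega$ if $d=0$), and $p_{i,j}=\mathbf P(B_i\cap A_{j_1}\cdots A_{j_d})$. For $j\in J_d$ and $k=1,2,3$ define $$s_k(j)=\sum_{i=1}^{n-d+1} C_{i+d-1}^{k+d-1}\,\frac{p_{i+d-1,j}}{C_{i+d-1}^d}.$$ Equivalently, $$s_k(j)=\frac{d!}{(k+d-1)!}\sum \mathbf P\bigl(A_{u_1}\cdots A_{u_{k-1}}A_{j_1}\cdots A_{j_d}\bigr),$$ where the sum is over all ordered $(k-1)$-tuples of pairwise distinct indices $u_1,\dots,u_{k-1}\in\{1,\dots,n\}\setminus\{j_1,\dots,j_d\}$ (for $d=0$ over $\{1,\dots,n\}$); in particular $s_1(j)=\mathbf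 P(A_{j_1}\cdots A_{j_d})$. The random variables $s_k^{\mathcal A}(j)$ are defined by the right-hand side of the last formula with $\mathbf P(\cdot)$ replaced by $\mathbf P(\cdot\mid\mathcal A)$. *)

theory Defs
  imports "HOL-Probability.Probability"
begin

text \<open>
  The events are \<open>A 1, \<dots>, A n\<close>; values of \<open>A\<close> outside \<open>{1..n}\<close> are irrelevant.
\<close>

definition exactly :: "'a measure \<Rightarrow> nat \<Rightarrow> (nat \<Rightarrow> 'a set) \<Rightarrow> nat \<Rightarrow> 'a set" where
  "exactly M n A i = {\<omega> \<in> space M. card {k \<in> {1..n}. \<omega> \<in> A k} = i}"

definition at_least :: "'a measure \<Rightarrow> nat \<Rightarrow> (nat \<Rightarrow> 'a set) \<Rightarrow> nat \<Rightarrow> 'a set" where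
  "at_least M n A r = (\<Union>i\<in>{r..n}. exactly M n A i)"

text \<open>
  Index tuples are lists. For \<open>d = 0\<close> the only tuple is the empty list, which takes the role
  of the dummy index in \<open>J\<^sub>0 = {0}\<close>; the corresponding intersection is the whole space.
\<close>

definition J :: "nat \<Rightarrow> nat \<Rightarrow> nat list set" where
  "J n d = {j. length j = d \<and> sorted_wrt (<) j \<and> set j \<subseteq> {1..n}}"

definition inter :: "'a measure \<Rightarrow> (nat \<Rightarrow> 'a set) \<Rightarrow> nat list \<Rightarrow> 'a set" where
  "inter M A j = space M \<inter> (\<Inter>i\<in>set j. A i)"

definition s_comp :: "'a measure \<Rightarrow> nat \<Rightarrow> (nat \<Rightarrow> 'a set) \<Rightarrow> nat \<Rightarrow> nat \<Rightarrow> nat list \<Rightarrow> real" where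
  "s_comp M n A d k j =
    (\<Sum>i = 1..n - d + 1. real ((i + d - 1) choose (k + d - 1)) *
       (measure M (exactly M n A (i + d - 1) \<inter> inter M A j) / real ((i + d - 1) choose d)))"

definition s :: "'a measure \<Rightarrow> nat \<Rightarrow> (nat \<Rightarrow> 'a set) \<Rightarrow> nat \<Rightarrow> nat list \<Rightarrow> real ^ 3" where
  "s M n A d j = vector [s_comp M n A d 1 j, s_comp M n A d 2 j, s_comp M n A d 3 j]"

definition cprob :: "'a measure \<Rightarrow> 'a measure \<Rightarrow> 'a set \<Rightarrow> 'a \<Rightarrow> real" where
  "cprob M G E = real_cond_exp M G (indicator E)"

text \<open>
  The conditional quantities are defined through ordered tuples \<open>u\<close> of pairwise distinct
  indices not occurring in \<open>j\<close>, not through the formula of \<^const>\<open>s_comp\<close>.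
\<close>

definition s_comp_cond ::
  "'a measure \<Rightarrow> 'a measure \<Rightarrow> nat \<Rightarrow> (nat \<Rightarrow> 'a set) \<Rightarrow> nat \<Rightarrow> nat \<Rightarrow> nat list \<Rightarrow> 'a \<Rightarrow> real" where
  "s_comp_cond M G n A d k j \<omega> =
    fact d / fact (k + d - 1) *
      (\<Sum>u \<in> {u. length u = k - 1 \<and> distinct u \<and> set u \<subseteq> {1..n} - set j}.
         cprob M G (inter M A (u @ j)) \<omega>)"

definition s_cond ::
  "'a measure \<Rightarrow> 'a measure \<Rightarrow> nat \<Rightarrow> (nat \<Rightarrow> 'a set) \<Rightarrow> nat \<Rightarrow> nat list \<Rightarrow> 'a \<Rightarrow> real ^ 3" where
  "s_cond M G n A d j \<omega> = vector
     [s_comp_cond M G n A d 1 j \<omega>, s_comp_cond M G n A d 2 j \<omega>, s_comp_cond M G n A d 3 j \<omega>]"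

definition Delta :: "nat \<Rightarrow> nat \<Rightarrow> nat \<Rightarrow> real" where
  "Delta r d m = (real r - real d - real m) * (real r - real d - real m + 1)"

definition alpha :: "nat \<Rightarrow> nat \<Rightarrow> nat \<Rightarrow> real ^ 3" where
  "alpha r d m = (1 / (Delta r d m * real (r choose d))) *\<^sub>R vector
     [real m * (real m - 1),
      - 2 * (real d + 1) * (real m - 1),
      (real d + 1) * (real d + 2)]"

definition Delta1 :: "nat \<Rightarrow> nat \<Rightarrow> nat \<Rightarrow> real" where
  "Delta1 n r d = real (n choose (d + 2)) * real (r choose (d + 1))
     - real (n choose (d + 1)) * real (r choose (d + 2))"

definition beta :: "nat \<Rightarrow> nat \<Rightarrow> nat \<Rightarrow> real ^ 3" where
  "beta n r d = (1 / Delta1 n r d) *\<^sub>R vector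
     [0,
      real (n choose (d + 2)) - real (r choose (d + 2)),
      real (r choose (d + 1)) - real (n choose (d + 1))]"

definition delta :: "nat \<Rightarrow> nat \<Rightarrow> nat \<Rightarrow> real ^ 3" where
  "delta n r d = (1 / Delta1 n r d) *\<^sub>R vector
     [0, real (n choose (d + 2)), - real (n choose (d + 1))]"

text \<open>
  Only used for \<open>m \<ge> 2\<close>, so the truncated subtraction in \<open>m + d - 1\<close> is harmless.
\<close>

definition gamma :: "nat \<Rightarrow> nat \<Rightarrow> nat \<Rightarrow> real ^ 3" where
  "gamma r d m =
    (let \<rho> = real r - real d; \<mu> = real m; \<Delta> = Delta r d m;
         a = real ((m + d - 1) choose d); b = real ((m + d) choose d); c = real (r choose d)
     in vector
       [\<mu> * \<rho> * (\<rho> - \<mu>) / (a * \<Delta>)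
          - (\<mu> - 1) * \<rho> * (\<rho> - \<mu> + 1) / (b * \<Delta>)
          + \<mu> * (\<mu> - 1) / (c * \<Delta>),
        (real d + 1) *
          (- ((\<rho> - \<mu>) * (\<rho> + \<mu> - 1) / (a * \<Delta>))
           + (\<rho> - \<mu> + 1) * (\<rho> + \<mu> - 2) / (b * \<Delta>)
           - 2 * (\<mu> - 1) / (c * \<Delta>)),
        (real d + 1) * (real d + 2) *
          ((\<rho> - \<mu>) / (a * \<Delta>) - (\<rho> - \<mu> + 1) / (b * \<Delta>) + 1 / (c * \<Delta>))])"

definition denom :: "nat \<Rightarrow> nat \<Rightarrow> real ^ 3 \<Rightarrow> real" where
  "denom r d x = (real r - real d) * x $ 1 - (real d + 1) * x $ 2"

definition star :: "nat \<Rightarrow> nat \<Rightarrow> real ^ 3 \<Rightarrow> nat \<Rightarrow> bool" where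
  "star r d x m \<longleftrightarrow>
    (let q = (real d + 1) * (((real r - real d - 1) * x $ 2 - (real d + 2) * x $ 3) / denom r d x)
     in real m - 1 \<le> q \<and> q \<le> real m)"

end

theory Submission
  imports Defs
begin

text \<open>
  Fix \<open>j\<close> and let \<open>y i\<close> be the (conditional) probability that \<open>A\<^sub>j\<close> and exactly \<open>i + d\<close> events occur.
  Up to constants, \<open>s\<^sub>1, s\<^sub>2, s\<^sub>3\<close> are the factorial moments of \<open>y\<close> of order 0, 1, 2, so \<open>v \<bullet> s(j)\<close> is
  \<open>\<Sum>i. q i * y i\<close> for a quadratic polynomial \<open>q\<close>, whereas the \<open>j\<close>-th share of \<open>P\<^sub>r\<close> has weights
  \<open>h i = 1 / C(i + d, d)\<close> for \<open>i \<ge> r - d\<close> and 0 below (for \<open>p\<^sub>r\<close>, only the weight at \<open>i = r - d\<close>).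
  An upper bound is thus a quadratic majorant of these weights on \<open>{0..n - d}\<close>.
  The vectors \<open>\<alpha>\<close>, \<open>\<beta>\<close>, \<open>\<gamma>\<close>, \<open>\<delta>\<close> are interpolating quadratics, all equal to \<open>h\<close> at \<open>r - d\<close>:
  \<open>\<alpha>\<close> vanishes at \<open>m - 1\<close> and \<open>m\<close>; \<open>\<beta>\<close> and \<open>\<delta>\<close> vanish at 0 and take at \<open>n - d\<close> the values \<open>h (n - d)\<close> and 0;
  \<open>\<gamma>\<close> agrees with \<open>h\<close> at \<open>m - 1\<close> and \<open>m\<close>. The majorization follows from the alternating signs of the
  differences of \<open>h\<close> up to order three.
  Passing from \<open>m\<close> to \<open>m + 1\<close> changes \<open>\<alpha> \<bullet> s\<close> and \<open>\<gamma> \<bullet> s\<close> by a factor of constant sign times an affine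
  function of \<open>m\<close> whose zero is the middle term of the optimality condition.
\<close>

section \<open>Differences of reciprocal binomial coefficients\<close>

text \<open>An outcome at which exactly \<open>i + d\<close> events occur lies in C(i + d, d) of the
  intersections indexed by \<open>J n d\<close>; with this weight on each of them it is counted
  once.\<close>

definition recip_binom :: "nat \<Rightarrow> nat \<Rightarrow> real" where
  "recip_binom d i = 1 / real ((i + d) choose d)"

section \<open>Extrapolation inequalities from the sign of second and third differences\<close>

text \<open>The left side is the value at \<open>k\<close> of the line through the points at
  \<open>k + j\<close> and \<open>k + j + 1\<close>. Shifting both nodes by one to the right lowers
  it by \<open>j + 1\<close> times a second difference.\<close>

lemma convex_seq_extrapolate_left:
  fixes f :: "nat \<Rightarrow> real"
  assumes "\<And>i. 0 \<le> f i - 2 * f (i + 1) + f (i + 2)"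
  shows "real (j + 1) * f (k + j) - real j * f (k + j + 1) \<le> f k"
proof (induction j)
  case (Suc j)
  have "0 \<le> real (j + 1) * (f (k + j) - 2 * f (k + j + 1) + f (k + j + 2))"
    using assms[of "k + j"] by (intro mult_nonneg_nonneg) auto
  then show ?case
    using Suc by (simp add: algebra_simps)
qed simp

lemma convex_seq_extrapolate_right:
  fixes f :: "nat \<Rightarrow> real"
  assumes "\<And>i. 0 \<le> f i - 2 * f (i + 1) + f (i + 2)"
  shows "f k + real j * (f (k + 1) - f k) \<le> f (k + j)"
proof -
  have slope: "f (k + 1) - f k \<le> f (k + j + 1) - f (k + j)" for j
  proof (induction j)
    case (Suc j)
    then show ?case using assms[of "k + j"] by simp
  qed simp
  show ?thesis
  proof (induction j)
    case (Suc j)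
    then show ?case using slope[of j] by (simp add: algebra_simps)
  qed simp
qed

text \<open>Both ends are compared with the line through the points at \<open>i\<close> and
  \<open>i + 1\<close>; the weights \<open>b - i\<close> and \<open>i - a\<close> make its slope
  cancel.\<close>

lemma convex_seq_chord:
  fixes f :: "nat \<Rightarrow> real"
  assumes "\<And>i. 0 \<le> f i - 2 * f (i + 1) + f (i + 2)" and "a \<le> i" "i \<le> b"
  shows "(real b - real a) * f i \<le> (real b - real i) * f a + (real i - real a) * f b"
proof -
  have "f i - (real i - real a) * (f (i + 1) - f i) \<le> f a"
    using convex_seq_extrapolate_left[of f "i - a" a] assms by (simp add: algebra_simps of_nat_diff)
  then have 1: "(real b - real i) * (f i - (real i - real a) * (f (i + 1) - f i)) \<le> (real b - real i) * f a"
    using assms by (intro mult_left_mono) auto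
  have "f i + (real b - real i) * (f (i + 1) - f i) \<le> f b"
    using convex_seq_extrapolate_right[of f i "b - i"] assms by (simp add: of_nat_diff)
  then have 2: "(real i - real a) * (f i + (real b - real i) * (f (i + 1) - f i)) \<le> (real i - real a) * f b"
    using assms by (intro mult_left_mono) auto
  from add_mono[OF 1 2] show ?thesis by (simp add: algebra_simps)
qed

text \<open>The left side is the value at \<open>k\<close> of the parabola through the points at
  \<open>k + j\<close>, \<open>k + j + 1\<close>, \<open>k + j + 2\<close>. Shifting the nodes by
  one lowers it by (j + 1)(j + 2)/2 times the expression assumed nonnegative.\<close>

lemma third_diff_extrapolate_left:
  fixes f :: "nat \<Rightarrow> real"
  assumes "\<And>i. 0 \<le> f i - 3 * f (i + 1) + 3 * f (i + 2) - f (i + 3)"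
  shows "(real j + 1) * (real j + 2) / 2 * f (k + j) - real j * (real j + 2) * f (k + j + 1)
     + real j * (real j + 1) / 2 * f (k + j + 2) \<le> f k"
proof (induction j)
  case (Suc j)
  define a b c e where "a = f (k + j)" and "b = f (k + j + 1)" and "c = f (k + j + 2)" and "e = f (k + j + 3)"
  have "0 \<le> (real j + 1) * (real j + 2) / 2 * (a - 3 * b + 3 * c - e)"
    using assms[of "k + j"] unfolding a_def b_def c_def e_def
    by (intro mult_nonneg_nonneg) (auto simp: add_ac)
  also have "\<dots> = (real j + 1) * (real j + 2) / 2 * a - real j * (real j + 2) * b + real j * (real j + 1) / 2 * c
    - ((real (Suc j) + 1) * (real (Suc j) + 2) / 2 * b - real (Suc j) * (real (Suc j) + 2) * c
      + real (Suc j) * (real (Suc j) + 1) / 2 * e)"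
    by (simp add: field_simps)
  finally have "(real (Suc j) + 1) * (real (Suc j) + 2) / 2 * b - real (Suc j) * (real (Suc j) + 2) * c
      + real (Suc j) * (real (Suc j) + 1) / 2 * e \<le> f k"
    using Suc unfolding a_def b_def c_def by linarith
  moreover have "k + Suc j = k + j + 1" "k + Suc j + 1 = k + j + 2" "k + Suc j + 2 = k + j + 3"
    by simp_all
  ultimately show ?case
    by (simp only: b_def c_def e_def)
qed simp

section \<open>Signs of the differences of 1 / C(i + d, d)\<close>

lemma binomial_Suc_lower: "real (n choose Suc k) = real (n - k) * real (n choose k) / real (Suc k)"
proof -
  have "Suc k * (n choose Suc k) = (n - k) * (n choose k)"
    by (simp only: binomial_absorption binomial_absorb_comp)
  then have "real (Suc k) * real (n choose Suc k) = real (n - k) * real (n choose k)"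
    by (simp only: flip: of_nat_mult)
  then show ?thesis
    by (simp add: field_simps del: of_nat_Suc)
qed

lemma recip_binom_pos: "0 < recip_binom d i"
  by (simp add: recip_binom_def)

lemma recip_binom_Suc:
  "recip_binom d (Suc i) = recip_binom d i * (real i + 1) / (real i + 1 + real d)"
proof -
  \<comment> \<open>Complementing the lower index makes it run with \<open>i\<close>, as the
    absorption identity requires.\<close>
  have "(Suc i + d choose d) = (Suc (i + d) choose Suc i)" "(i + d choose d) = (i + d choose i)"
    using binomial_symmetric[of d "i + d"] binomial_symmetric[of d "Suc i + d"] by simp_all
  then have "Suc i * (Suc i + d choose d) = Suc (i + d) * ((i + d) choose d)"
    by (simp only: Suc_times_binomial)
  then have "real (Suc i) * real (Suc i + d choose d) = real (Suc (i + d)) * real ((i + d) choose d)"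
    by (simp only: flip: of_nat_mult)
  moreover have "real (Suc i + d choose d) > 0" "real (i + d choose d) > 0"
    by simp_all
  ultimately show ?thesis
    unfolding recip_binom_def by (simp add: frac_eq_eq add_ac mult_ac del: binomial_Suc_Suc)
qed

lemma recip_binom_antimono: "i \<le> k \<Longrightarrow> recip_binom d k \<le> recip_binom d i"
proof (rule lift_Suc_antimono_le[where f = "recip_binom d"])
  show "recip_binom d (Suc i) \<le> recip_binom d i" for i
    using recip_binom_pos[of d i] by (simp add: recip_binom_Suc field_simps)
qed

text \<open>The ratio of consecutive terms turns the difference into \<open>recip_binom d i\<close>
  times an explicit nonnegative fraction. The third difference is treated in the same way.\<close>

lemma recip_binom_second_diff:
  "0 \<le> recip_binom d i - 2 * recip_binom d (i + 1) + recip_binom d (i + 2)"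
proof -
  have "recip_binom d i - 2 * recip_binom d (i + 1) + recip_binom d (i + 2)
    = recip_binom d i * real d * (real d + 1) / ((real i + 1 + real d) * (real i + 2 + real d))"
    by (simp add: recip_binom_Suc numeral_2_eq_2) (simp add: divide_simps, simp add: algebra_simps)
  then show ?thesis
    using recip_binom_pos[of d i] by simp
qed

lemma recip_binom_third_diff:
  "0 \<le> recip_binom d i - 3 * recip_binom d (i + 1) + 3 * recip_binom d (i + 2) - recip_binom d (i + 3)"
proof -
  have nz: "real i + 1 + real d \<noteq> 0" "real i + 2 + real d \<noteq> 0" "real i + 3 + real d \<noteq> 0" by linarith+
  have "recip_binom d (i + 2) = recip_binom d i * ((real i + 1) / (real i + 1 + real d)) * ((real i + 2) / (real i + 2 + real d))"
    "recip_binom d (i + 3) = recip_binom d i * ((real i + 1) / (real i + 1 + real d)) * ((real i + 2) / (real i + 2 + real d)) * ((real i + 3) / (real i + 3 + real d))"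
    "recip_binom d (i + 1) = recip_binom d i * ((real i + 1) / (real i + 1 + real d))"
    by (simp_all add: recip_binom_Suc numeral_2_eq_2 numeral_3_eq_3 add_ac)
  then have "recip_binom d i - 3 * recip_binom d (i + 1) + 3 * recip_binom d (i + 2) - recip_binom d (i + 3)
    = recip_binom d i * real d * (real d + 1) * (real d + 2)
      / ((real i + 1 + real d) * (real i + 2 + real d) * (real i + 3 + real d))"
    using nz by (simp only:) (simp add: divide_simps, simp add: algebra_simps)
  then show ?thesis
    using recip_binom_pos[of d i] by simp
qed

text \<open>Convexity of h(i) / i for i \<ge> 1, with the index shifted to start at 0. It serves
  \<open>beta\<close>: that quadratic vanishes at 0, so after division by i the majorization is a
  chord inequality.\<close>

lemma recip_binom_over_index_second_diff:
  fixes d :: nat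
  defines "f \<equiv> \<lambda>i. recip_binom d (Suc i) / (real i + 1)"
  shows "0 \<le> f i - 2 * f (i + 1) + f (i + 2)"
proof -
  have nz: "real i + 1 \<noteq> 0" "real i + 2 \<noteq> 0" "real i + 3 \<noteq> 0" "real i + 1 + real d \<noteq> 0"
    "real i + 2 + real d \<noteq> 0" "real i + 3 + real d \<noteq> 0" by linarith+
  have "f i = recip_binom d (Suc i) / (real i + 1)"
    "f (i + 1) = recip_binom d (Suc i) / (real i + 2 + real d)"
    "f (i + 2) = recip_binom d (Suc i) * (real i + 2) / ((real i + 2 + real d) * (real i + 3 + real d))"
    unfolding f_def using nz by (simp_all add: recip_binom_Suc numeral_2_eq_2 add_ac)
  then have "f i - 2 * f (i + 1) + f (i + 2) = recip_binom d (Suc i) * (real d + 1) * (real d + 2)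
      / ((real i + 1) * (real i + 2 + real d) * (real i + 3 + real d))"
    using nz by (simp only:) (simp add: divide_simps, simp add: algebra_simps)
  then show ?thesis
    using recip_binom_pos[of d "Suc i"] by simp
qed

section \<open>The interpolating quadratics\<close>

text \<open>The moment vector of a unit mass at \<open>i\<close>, so that
  \<open>v \<bullet> moment_vec d i\<close> is the quadratic belonging to \<open>v\<close>. The
  argument is real, which makes it a polynomial identity in \<open>i\<close>.\<close>

definition moment_vec :: "nat \<Rightarrow> real \<Rightarrow> real ^ 3" where
  "moment_vec d i = vector [1, i / (real d + 1), i * (i - 1) / ((real d + 1) * (real d + 2))]"

text \<open>Numerator of the threshold in \<open>star\<close>; the denominator is
  \<open>denom\<close>.\<close>

definition star_num :: "nat \<Rightarrow> nat \<Rightarrow> real ^ 3 \<Rightarrow> real" where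
  "star_num r d x = (real d + 1) * ((real r - real d - 1) * x $ 2 - (real d + 2) * x $ 3)"

lemma inner_vec3: "(v :: real ^ 3) \<bullet> w = v $ 1 * w $ 1 + v $ 2 * w $ 2 + v $ 3 * w $ 3"
  by (simp add: inner_vec_def sum_3)

section \<open>The vector \<open>alpha\<close>: roots and dependence on m\<close>

lemma inner_alpha:
  "alpha r d m \<bullet> x = (real m * (real m - 1) * x $ 1 - 2 * (real m - 1) * ((real d + 1) * x $ 2)
     + (real d + 1) * (real d + 2) * x $ 3) / (Delta r d m * real (r choose d))"
  by (simp add: alpha_def inner_vec3 diff_divide_distrib add_divide_distrib algebra_simps)

lemma alpha_moment_vec:
  "alpha r d m \<bullet> moment_vec d i = (i - real m) * (i - real m + 1) / (Delta r d m * real (r choose d))"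
proof -
  have "real d + 1 \<noteq> 0" "real d + 2 \<noteq> 0" by linarith+
  then show ?thesis
  unfolding inner_alpha by (simp add: moment_vec_def) (simp add: algebra_simps)
qed

text \<open>The cubic in the prefactor is positive for \<open>m < r - d - 1\<close> and negative for
  \<open>m \<ge> r - d + 2\<close>, hence the opposite sign conditions on \<open>denom\<close> in
  the two ranges.\<close>

lemma alpha_step:
  assumes "real r - real d - real m \<noteq> 0" "real r - real d - real m + 1 \<noteq> 0"
    "real r - real d - real m - 1 \<noteq> 0" "d \<le> r"
  shows "alpha r d (Suc m) \<bullet> x - alpha r d m \<bullet> x =
    2 / ((real r - real d - real m - 1) * (real r - real d - real m) * (real r - real d - real m + 1)
      * real (r choose d)) * (real m * denom r d x - star_num r d x)"
proof -
  define u where "u = real r - real d - real m"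
  have r: "real r = real d + real m + u" by (simp add: u_def)
  have c: "real (r choose d) \<noteq> 0" using assms by simp
  have D: "Delta r d m = u * (u + 1)" "Delta r d (Suc m) = (u - 1) * u"
    by (simp_all add: Delta_def u_def algebra_simps)
  have nz: "u \<noteq> 0" "u + 1 \<noteq> 0" "u - 1 \<noteq> 0" using assms by (simp_all add: u_def)
  show ?thesis
    unfolding inner_alpha D denom_def star_num_def u_def[symmetric] using nz c
    by (simp add: divide_simps r del: binomial_eq_0_iff) (simp add: algebra_simps)
qed

section \<open>The vector \<open>gamma\<close>: Lagrange form, steps in m and majorization\<close>

text \<open>Lagrange interpolation at \<open>m - 1\<close>, \<open>m\<close> and
  \<open>r - d\<close>. Each bracket is a product of two linear factors written in factorial
  moments, for example (i - \<rho>)(i - m) = i(i - 1) - (\<rho> + m - 1)i + \<rho>m.\<close>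

lemma inner_gamma:
  fixes x :: "real ^ 3"
  assumes "1 \<le> m" "d \<le> r"
  defines "u \<equiv> real r - real d - real m" and "\<rho> \<equiv> real r - real d"
  defines "E0 \<equiv> x $ 1" and "E1 \<equiv> (real d + 1) * x $ 2" and "E2 \<equiv> (real d + 1) * (real d + 2) * x $ 3"
  shows "gamma r d m \<bullet> x =
    (u * recip_binom d (m - 1) * (E2 - (\<rho> + real m - 1) * E1 + \<rho> * real m * E0)
     - (u + 1) * recip_binom d m * (E2 - (\<rho> + real m - 2) * E1 + \<rho> * (real m - 1) * E0)
     + recip_binom d (r - d) * (E2 - 2 * (real m - 1) * E1 + real m * (real m - 1) * E0)) / (u * (u + 1))"
proof -
  have "recip_binom d (m - 1) = 1 / real ((m + d - 1) choose d)"
    "recip_binom d m = 1 / real ((m + d) choose d)" "recip_binom d (r - d) = 1 / real (r choose d)"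
    using assms(1,2) by (simp_all add: recip_binom_def)
  moreover have "Delta r d m = u * (u + 1)" "u = \<rho> - real m"
    by (simp_all add: Delta_def u_def \<rho>_def)
  moreover define a b c where "a = real ((m + d - 1) choose d)"
    and "b = real ((m + d) choose d)" and "c = real (r choose d)"
  moreover define D where "D = Delta r d m"
  ultimately have e: "recip_binom d (m - 1) = 1 / a" "recip_binom d m = 1 / b"
    "recip_binom d (r - d) = 1 / c" "u * (u + 1) = D"
    "u = \<rho> - real m" by simp_all
  show ?thesis
    unfolding gamma_def Let_def inner_vec3 vector_3 E0_def E1_def E2_def e(1-4)
      a_def[symmetric] b_def[symmetric] c_def[symmetric] D_def[symmetric] \<rho>_def[symmetric]
    unfolding e(5)
    by (simp add: divide_inverse distrib_left distrib_right left_diff_distrib right_diff_distrib mult_ac)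
qed

lemma moment_vec_nth:
  "moment_vec d i $ 1 = 1" "(real d + 1) * moment_vec d i $ 2 = i"
  "(real d + 1) * (real d + 2) * moment_vec d i $ 3 = i * (i - 1)"
proof -
  have "real d + 1 \<noteq> 0" "real d + 2 \<noteq> 0" by linarith+
  then show "moment_vec d i $ 1 = 1" "(real d + 1) * moment_vec d i $ 2 = i"
    "(real d + 1) * (real d + 2) * moment_vec d i $ 3 = i * (i - 1)"
    by (simp_all add: moment_vec_def)
qed

lemma gamma_moment_vec:
  assumes "1 \<le> m" "d \<le> r"
  defines "u \<equiv> real r - real d - real m" and "\<rho> \<equiv> real r - real d"
  shows "gamma r d m \<bullet> moment_vec d i =
    (u * recip_binom d (m - 1) * ((i - \<rho>) * (i - real m))
     - (u + 1) * recip_binom d m * ((i - \<rho>) * (i - real m + 1))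
     + recip_binom d (r - d) * ((i - real m) * (i - real m + 1))) / (u * (u + 1))"
proof -
  show ?thesis
    unfolding inner_gamma[OF assms(1,2)] moment_vec_nth u_def[symmetric] unfolding \<rho>_def[symmetric]
    by (rule arg_cong2[where f = "(/)"]) (simp_all add: algebra_simps)
qed

text \<open>Twice the third divided difference of \<open>recip_binom d\<close> at \<open>r - d\<close>, \<open>m - 1\<close>, \<open>m\<close>, \<open>m + 1\<close>.\<close>

definition gamma_slope :: "nat \<Rightarrow> nat \<Rightarrow> nat \<Rightarrow> real" where
  "gamma_slope r d m =
    (let u = real r - real d - real m
     in 2 * (recip_binom d (r - d) - (recip_binom d (m - 1) * (u * (u - 1) / 2)
        - recip_binom d m * ((u + 1) * (u - 1)) + recip_binom d (m + 1) * ((u + 1) * u / 2)))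
      / ((u - 1) * u * (u + 1)))"

text \<open>Both quadratics interpolate at \<open>r - d\<close> and \<open>m\<close>, while the
  remaining nodes \<open>m - 1\<close> and \<open>m + 1\<close> are two apart. By Newton's formula
  the difference carries twice a third divided difference.\<close>

lemma gamma_step:
  assumes "r - d + 2 \<le> m" "d \<le> r"
  shows "gamma r d (Suc m) \<bullet> x - gamma r d m \<bullet> x =
    gamma_slope r d m * (real m * denom r d x - star_num r d x)"
proof -
  define u where "u = real r - real d - real m"
  have u: "real r - real d - real (Suc m) = u - 1" by (simp add: u_def)
  have nz: "u \<noteq> 0" "u + 1 \<noteq> 0" "u - 1 \<noteq> 0"
    using assms by (simp_all add: u_def of_nat_diff)
  have \<rho>: "real r - real d = real m + u" by (simp add: u_def)
  define E1 E2 where "E1 = (real d + 1) * x $ 2" and "E2 = (real d + 1) * (real d + 2) * x $ 3"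
  have num: "star_num r d x = (real m + u - 1) * E1 - E2"
    unfolding star_num_def \<rho> E1_def E2_def by (simp add: algebra_simps)
  have den: "denom r d x = (real m + u) * x $ 1 - E1"
    unfolding denom_def \<rho> E1_def by simp
  have m: "1 \<le> m" "1 \<le> Suc m" using assms by simp_all
  have e: "Suc m - 1 = m" "m + 1 = Suc m" "real (Suc m) = real m + 1" by simp_all
  show ?thesis
    unfolding inner_gamma[OF m(1) assms(2)] inner_gamma[OF m(2) assms(2)] num den gamma_slope_def Let_def
      u u_def[symmetric] E1_def[symmetric] E2_def[symmetric] unfolding \<rho> e
    using nz
    by (simp add: divide_simps) (simp add: algebra_simps)
qed

text \<open>The bracket compares \<open>recip_binom d (r - d)\<close> with the value there of the
  parabola through the points at \<open>m - 1\<close>, \<open>m\<close>, \<open>m + 1\<close>, and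
  is nonnegative by extrapolation. The denominator is a product of three negative numbers.\<close>

lemma gamma_slope_nonpos:
  assumes "r - d + 2 \<le> m" "d \<le> r"
  shows "gamma_slope r d m \<le> 0"
proof -
  define u where "u = real r - real d - real m"
  define j where "j = m - 1 - (r - d)"
  have j: "m - 1 = r - d + j" "m = r - d + j + 1" "m + 1 = r - d + j + 2" "u = - (real j + 1)"
    using assms by (simp_all add: j_def u_def of_nat_diff)
  have pos: "(u - 1) * u * (u + 1) < 0"
    using assms by (simp add: mult_neg_neg mult_pos_neg u_def of_nat_diff)
  have "0 \<le> recip_binom d (r - d) - (recip_binom d (m - 1) * (u * (u - 1) / 2)
        - recip_binom d m * ((u + 1) * (u - 1)) + recip_binom d (m + 1) * ((u + 1) * u / 2))"
    using third_diff_extrapolate_left[of "recip_binom d" j "r - d", OF recip_binom_third_diff]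
    unfolding j(1,3,4) unfolding j(2) by (simp add: algebra_simps)
  then show ?thesis
    using pos unfolding gamma_slope_def Let_def u_def[symmetric]
    by (intro divide_nonneg_neg) auto
qed

text \<open>For a unit mass at \<open>i\<close> the affine factor of a step vanishes at
  \<open>m = i\<close>, which locates the turning point in \<open>m\<close> of the pointwise
  values.\<close>

lemma moment_step_factor:
  "real m * denom r d (moment_vec d i) - star_num r d (moment_vec d i)
    = (real m - i) * (real r - real d - i)"
proof -
  have "star_num r d (moment_vec d i) = (real r - real d - 1) * ((real d + 1) * moment_vec d i $ 2)
      - (real d + 1) * (real d + 2) * moment_vec d i $ 3"
    by (simp add: star_num_def algebra_simps)
  then show ?thesis
    unfolding denom_def moment_vec_nth by (simp add: algebra_simps)
qed

text \<open>\<open>gamma r d m \<bullet> moment_vec d i\<close> is the quadratic in \<open>i\<close> that interpolates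
  \<open>recip_binom d\<close> at \<open>r - d\<close>, \<open>m - 1\<close> and \<open>m\<close>.\<close>

lemma gamma_interpolates:
  assumes "r - d + 2 \<le> m" "d \<le> r" "i = r - d \<or> i = m - 1 \<or> i = m"
  shows "gamma r d m \<bullet> moment_vec d (real i) = recip_binom d i"
proof -
  define u where "u = real r - real d - real m"
  have nz: "u \<noteq> 0" "u + 1 \<noteq> 0"
    using assms by (simp_all add: u_def of_nat_diff)
  have \<rho>: "real r - real d = real m + u" by (simp add: u_def)
  have m: "1 \<le> m" using assms by simp
  have r: "real (r - d) = real m + u" using assms by (simp add: u_def of_nat_diff)
  show ?thesis
    using assms(3) nz m unfolding gamma_moment_vec[OF m assms(2)] u_def[symmetric] unfolding \<rho>
    by (auto simp: r of_nat_diff)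
qed

text \<open>Two consecutive interpolants also agree at \<open>m\<close>, so their difference is
  \<open>gamma_slope r d m * (m - i) * (r - d - i)\<close>; by its sign the value at \<open>i\<close> decreases
  when \<open>m\<close> moves towards \<open>i\<close>, where interpolation gives equality.\<close>

lemma gamma_ge_recip_binom:
  assumes "r - d + 2 \<le> m" "d \<le> r" "r - d \<le> i"
  shows "recip_binom d i \<le> gamma r d m \<bullet> moment_vec d (real i)"
proof -
  let ?g = "\<lambda>m. gamma r d m \<bullet> moment_vec d (real i)"
  have step: "?g (Suc m) - ?g m = gamma_slope r d m * ((real m - real i) * (real r - real d - real i))"
    if "r - d + 2 \<le> m" for m
    using gamma_step[OF that assms(2)] by (simp add: moment_step_factor)
  have neg: "real r - real d - real i \<le> 0"
    using assms by (simp add: of_nat_diff)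
  consider "i = r - d" | "r - d < i" "i < m" | "m \<le> i"
    using assms by linarith
  then show ?thesis
  proof cases
    case 1
    show ?thesis using gamma_interpolates[OF assms(1,2) disjI1[OF 1]] by linarith
  next
    case 2
    \<comment> \<open>The comparison starts at \<open>i + 1\<close>, where \<open>i\<close> is the
      node \<open>m - 1\<close>. The value \<open>m = i\<close> would not be admissible for
      \<open>i = r - d + 1\<close>.\<close>
    have "recip_binom d i \<le> ?g (i + 1 + k)" if "r - d + 2 \<le> i + 1" for k
    proof (induction k)
      case 0
      then show ?case using gamma_interpolates[of r d "i + 1" i] that assms by simp
    next
      case (Suc k)
      have "0 \<le> ?g (Suc (i + 1 + k)) - ?g (i + 1 + k)"
        using gamma_slope_nonpos[of r d "i + 1 + k"] neg that assms step[of "i + 1 + k"]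
        by (simp only:) (intro mult_nonpos_nonpos mult_nonneg_nonpos; simp)
      with Suc show ?case by simp
    qed
    from this[of "m - i - 1"] 2 show ?thesis by simp
  next
    case 3
    have "?g i \<le> ?g (i - k)" if "m + k \<le> i" for k
      using that
    proof (induction k)
      case (Suc k)
      have e: "Suc (i - Suc k) = i - k" using Suc by simp
      have "?g (i - k) - ?g (i - Suc k) \<le> 0"
        using gamma_slope_nonpos[of r d "i - Suc k"] neg Suc.prems assms step[of "i - Suc k"]
        unfolding e by (simp only:) (intro mult_nonpos_nonneg mult_nonpos_nonpos; simp)
      with Suc show ?case by simp
    qed simp
    from this[of "i - m"] have "?g i \<le> ?g m" using 3 by simp
    then show ?thesis using gamma_interpolates[of r d i i] assms 3 by simp
  qed
qed

text \<open>Newton's form with nodes \<open>m\<close>, \<open>m - 1\<close>, \<open>r - d\<close>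
  has only nonnegative terms to the left of \<open>r - d\<close>: the weights are positive,
  decreasing and convex.\<close>

lemma gamma_nonneg:
  assumes "r - d + 2 \<le> m" "d \<le> r" "i < r - d"
  shows "0 \<le> gamma r d m \<bullet> moment_vec d (real i)"
proof -
  define u where "u = real r - real d - real m"
  have nz: "u < 0" "u + 1 < 0"
    using assms by (simp_all add: u_def of_nat_diff)
  have \<rho>: "real r - real d = real m + u" by (simp add: u_def)
  have m: "1 \<le> m" using assms by simp
  define a b c where "a = recip_binom d (m - 1)" and "b = recip_binom d m" and "c = recip_binom d (r - d)"
  define j where "j = m - 1 - (r - d)"
  have j: "m - 1 = r - d + j" "m = r - d + j + 1" "u = - (real j + 1)"
    using assms by (simp_all add: j_def u_def of_nat_diff)
  have "(real j + 1) * recip_binom d (r - d + j) - real j * recip_binom d (r - d + j + 1) \<le> c"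
    using convex_seq_extrapolate_left[of "recip_binom d" j "r - d", OF recip_binom_second_diff]
    by (simp add: c_def add_ac)
  \<comment> \<open>This quotient is the second divided difference of \<open>recip_binom d\<close>
    at \<open>m - 1\<close>, \<open>m\<close>, \<open>r - d\<close>.\<close>
  then have second: "0 \<le> (u * a - (u + 1) * b + c) / (u * (u + 1))"
    using nz unfolding a_def b_def j(1,3) unfolding j(2)
    by (intro divide_nonneg_pos mult_neg_neg) (simp_all add: algebra_simps)
  have "gamma r d m \<bullet> moment_vec d (real i)
    = b + (real m - real i) * (a - b)
      + (u * a - (u + 1) * b + c) / (u * (u + 1)) * ((real i - real m) * (real i - real m + 1))"
    unfolding gamma_moment_vec[OF m assms(2)] u_def[symmetric] unfolding \<rho> a_def[symmetric] b_def[symmetric] c_def[symmetric]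
    using nz by (simp add: divide_simps) (simp add: algebra_simps)
  moreover have "0 \<le> b" "0 \<le> a - b"
    using recip_binom_pos[of d m] recip_binom_antimono[of "m - 1" m d] by (simp_all add: a_def b_def)
  moreover have "0 \<le> (real i - real m) * (real i - real m + 1)"
    using assms by (intro mult_nonpos_nonpos) auto
  moreover have "0 \<le> real m - real i"
    using assms by simp
  ultimately show ?thesis
    using second by (metis add_nonneg_nonneg mult_nonneg_nonneg)
qed

section \<open>The vectors \<open>beta\<close> and \<open>delta\<close>\<close>

text \<open>The extra term for \<open>beta\<close> is the quadratic that vanishes at 0 and
  \<open>r - d\<close> and raises the value at \<open>n - d\<close> from 0 to
  \<open>recip_binom d (n - d)\<close>.\<close>

lemma delta_moment_vec:
  assumes "d < r" "r < n"
  shows "delta n r d \<bullet> moment_vec d i =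
      i * (real n - real d - i) * recip_binom d (r - d) / ((real r - real d) * (real n - real r))"
    and "beta n r d \<bullet> moment_vec d i = delta n r d \<bullet> moment_vec d i +
      i * (i - (real r - real d)) * recip_binom d (n - d) / ((real n - real d) * (real n - real r))"
proof -
  have bin: "real (k choose (d + 1)) = real (k choose d) * (real k - real d) / (real d + 1)"
    "real (k choose (d + 2)) = real (k choose d) * (real k - real d) * (real k - real d - 1) / ((real d + 1) * (real d + 2))"
    if "d < k" for k
  proof -
    show 1: "real (k choose (d + 1)) = real (k choose d) * (real k - real d) / (real d + 1)"
      using binomial_Suc_lower[of k d] that by (simp add: mult.commute add.commute)
    have "real (k choose (d + 2)) = (real k - real d - 1) * real (k choose (d + 1)) / (real d + 2)"
      using binomial_Suc_lower[of k "Suc d"] that by (simp add: of_nat_diff add_ac)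
    then show "real (k choose (d + 2)) = real (k choose d) * (real k - real d) * (real k - real d - 1) / ((real d + 1) * (real d + 2))"
      unfolding 1 by (simp add: mult_ac)
  qed
  define N \<rho> where "N = real n - real d" and "\<rho> = real r - real d"
  define cn cr D where "cn = real (n choose d)" and "cr = real (r choose d)" and "D = real d + 1"
  have nr: "real n - real r = N - \<rho>" by (simp add: N_def \<rho>_def)
  have dn: "d < n" using assms by simp
  have rb: "recip_binom d (n - d) = 1 / cn" "recip_binom d (r - d) = 1 / cr"
    using assms by (simp_all add: recip_binom_def cn_def cr_def)
  have D: "D > 0" "real d + 2 = D + 1" "real d + 1 = D" by (simp_all add: D_def)
  have pos: "cn > 0" "cr > 0" "\<rho> > 0" "N > \<rho>" "N > 0"
    using assms by (simp_all add: cn_def cr_def \<rho>_def N_def)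
  \<comment> \<open>The factorization shows that \<open>Delta1\<close> is positive, so the divisions
    in \<open>beta\<close> and \<open>delta\<close> are genuine.\<close>
  have D1: "Delta1 n r d = cn * cr * N * \<rho> * (N - \<rho>) / (D * D * (D + 1))"
    unfolding Delta1_def bin[OF assms(1)] bin[OF dn] D
      N_def[symmetric] \<rho>_def[symmetric] cn_def[symmetric] cr_def[symmetric]
    using D(1) by (simp add: divide_simps) (simp add: algebra_simps)
  show delta: "delta n r d \<bullet> moment_vec d i =
      i * (real n - real d - i) * recip_binom d (r - d) / ((real r - real d) * (real n - real r))"
    unfolding delta_def D1 moment_vec_def bin[OF assms(1)] bin[OF dn] D nr rb
      N_def[symmetric] \<rho>_def[symmetric] cn_def[symmetric] cr_def[symmetric]
    using D(1) pos by (simp add: inner_vec3 divide_simps) (simp add: algebra_simps)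
  show "beta n r d \<bullet> moment_vec d i = delta n r d \<bullet> moment_vec d i +
      i * (i - (real r - real d)) * recip_binom d (n - d) / ((real n - real d) * (real n - real r))"
    unfolding delta
    unfolding beta_def D1 moment_vec_def bin[OF assms(1)] bin[OF dn] D nr rb
      N_def[symmetric] \<rho>_def[symmetric] cn_def[symmetric] cr_def[symmetric]
    using D(1) pos by (simp add: inner_vec3 divide_simps) (simp add: algebra_simps)
qed

text \<open>After division by \<open>i\<close> the claim says that h(i) / i lies below its chord
  between \<open>r - d\<close> and \<open>n - d\<close>.\<close>

lemma beta_ge_recip_binom:
  assumes "d < r" "r < n" "r - d \<le> i" "i \<le> n - d"
  shows "recip_binom d i \<le> beta n r d \<bullet> moment_vec d (real i)"
proof -
  define N \<rho> where "N = real n - real d" and "\<rho> = real r - real d"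
  have nr: "real n - real r = N - \<rho>" by (simp add: N_def \<rho>_def)
  have pos: "0 < \<rho>" "\<rho> < N" "0 < real i" "0 < N" using assms by (auto simp: N_def \<rho>_def)
  \<comment> \<open>All indices are one smaller because the convex sequence begins with h(1) /
    1.\<close>
  have "(real (n - d - 1) - real (r - d - 1)) * (recip_binom d (Suc (i - 1)) / (real (i - 1) + 1))
    \<le> (real (n - d - 1) - real (i - 1)) * (recip_binom d (Suc (r - d - 1)) / (real (r - d - 1) + 1))
      + (real (i - 1) - real (r - d - 1)) * (recip_binom d (Suc (n - d - 1)) / (real (n - d - 1) + 1))"
    using assms by (intro convex_seq_chord[OF recip_binom_over_index_second_diff]) auto
  moreover have "Suc (i - 1) = i" "Suc (r - d - 1) = r - d" "Suc (n - d - 1) = n - d"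
    "real (n - d - 1) = N - 1" "real (r - d - 1) = \<rho> - 1" "real (i - 1) = real i - 1"
    using assms by (auto simp: N_def \<rho>_def of_nat_diff)
  ultimately have "(N - \<rho>) * (recip_binom d i / real i) \<le>
      (N - real i) * (recip_binom d (r - d) / \<rho>) + (real i - \<rho>) * (recip_binom d (n - d) / N)"
    by simp
  then have "real i / (N - \<rho>) * ((N - \<rho>) * (recip_binom d i / real i)) \<le> real i / (N - \<rho>) *
      ((N - real i) * (recip_binom d (r - d) / \<rho>) + (real i - \<rho>) * (recip_binom d (n - d) / N))"
    using pos by (intro mult_left_mono) auto
  then show ?thesis
    unfolding delta_moment_vec[OF assms(1,2)] nr
    unfolding N_def[symmetric] \<rho>_def[symmetric]
    using pos by (simp add: distrib_left mult_ac)
qed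

text \<open>The value is a nonnegative multiple of (N - i) X - (\<rho> - i) Y. Since h decreases and
  \<rho> < N, both 0 \<le> Y \<le> X and 0 \<le> \<rho> - i \<le> N - i hold.\<close>

lemma beta_nonneg:
  assumes "d < r" "r < n" "i < r - d"
  shows "0 \<le> beta n r d \<bullet> moment_vec d (real i)"
proof -
  define N \<rho> where "N = real n - real d" and "\<rho> = real r - real d"
  define X Y where "X = recip_binom d (r - d) / \<rho>" and "Y = recip_binom d (n - d) / N"
  have nr: "real n - real r = N - \<rho>" by (simp add: N_def \<rho>_def)
  have pos: "0 < \<rho>" "\<rho> < N" "0 < N" "real i < \<rho>" using assms by (auto simp: N_def \<rho>_def)
  have "Y \<le> X"
    unfolding X_def Y_def using pos recip_binom_antimono[of "r - d" "n - d" d]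
      recip_binom_pos[THEN less_imp_le] assms
    by (intro frac_le) auto
  moreover have "0 \<le> Y"
    unfolding Y_def using pos recip_binom_pos[THEN less_imp_le] by simp
  ultimately have "(\<rho> - real i) * Y \<le> (N - real i) * X"
    using pos by (intro mult_mono) simp_all
  then have "0 \<le> real i / (N - \<rho>) * ((N - real i) * X + (real i - \<rho>) * Y)"
    using pos by (intro mult_nonneg_nonneg) (simp_all add: left_diff_distrib)
  then show ?thesis
    unfolding delta_moment_vec[OF assms(1,2)] nr X_def Y_def
    unfolding N_def[symmetric] \<rho>_def[symmetric]
    using pos by (simp add: distrib_left mult_ac)
qed

lemma delta_nonneg:
  assumes "d < r" "r < n" "i \<le> n - d"
  shows "0 \<le> delta n r d \<bullet> moment_vec d (real i)"
  using assms recip_binom_pos[of d "r - d", THEN less_imp_le] unfolding delta_moment_vec[OF assms(1,2)]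
  by (intro divide_nonneg_pos mult_nonneg_nonneg mult_pos_pos) auto

lemma delta_eq_recip_binom:
  assumes "d < r" "r < n"
  shows "delta n r d \<bullet> moment_vec d (real (r - d)) = recip_binom d (r - d)"
  using assms unfolding delta_moment_vec[OF assms(1,2)] by (simp add: of_nat_diff)

section \<open>The vector \<open>alpha\<close>: majorization\<close>

lemma alpha_at:
  assumes "d \<le> r" "m < r - d \<or> r - d + 2 \<le> m"
  shows "alpha r d m \<bullet> moment_vec d (real (r - d)) = recip_binom d (r - d)"
proof -
  have \<rho>: "real r - real d = real (r - d)"
    using assms by simp
  have "real (r - d) - real m \<noteq> 0" "real (r - d) - real m + 1 \<noteq> 0"
    using assms(2) by linarith+
  then show ?thesis
    unfolding alpha_moment_vec Delta_def recip_binom_def \<rho> using assms(1) by simp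
qed

text \<open>No integer lies strictly between the roots \<open>m - 1\<close> and \<open>m\<close>;
  between them the real quadratic is negative.\<close>

lemma consecutive_prod_nonneg: "0 \<le> (real i - real m) * (real i - real m + 1)"
proof (cases "i < m")
  case True
  then have "real i - real m \<le> 0" "real i - real m + 1 \<le> 0"
    by linarith+
  then show ?thesis
    by (rule mult_nonpos_nonpos)
next
  case False
  then show ?thesis
    by (intro mult_nonneg_nonneg) linarith+
qed

text \<open>For \<open>m = r - d\<close> and \<open>m = r - d + 1\<close> the factor
  \<open>Delta\<close> is 0, and division by zero gives the value 0.\<close>

lemma alpha_nonneg:
  assumes "d \<le> r"
  shows "0 \<le> alpha r d m \<bullet> moment_vec d (real i)"
proof -
  have "0 \<le> Delta r d m"
    using consecutive_prod_nonneg[of "r - d" m] assms by (simp add: Delta_def)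
  then show ?thesis
    unfolding alpha_moment_vec using consecutive_prod_nonneg[of i m]
    by (intro divide_nonneg_nonneg[OF _ mult_nonneg_nonneg]) simp_all
qed

text \<open>Equality holds at \<open>r - d\<close>; to the right of it the quadratic increases while
  \<open>recip_binom d\<close> decreases.\<close>

lemma alpha_ge_recip_binom:
  assumes "d \<le> r" "m < r - d" "r - d \<le> i"
  shows "recip_binom d i \<le> alpha r d m \<bullet> moment_vec d (real i)"
proof -
  have D: "0 \<le> Delta r d m"
    using consecutive_prod_nonneg[of "r - d" m] assms by (simp add: Delta_def)
  have "real m \<le> real (r - d)" "real (r - d) \<le> real i"
    using assms by linarith+
  then have "(real (r - d) - real m) * (real (r - d) - real m + 1) \<le> (real i - real m) * (real i - real m + 1)"
    by (intro mult_mono) linarith+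
  then have "alpha r d m \<bullet> moment_vec d (real (r - d)) \<le> alpha r d m \<bullet> moment_vec d (real i)"
    unfolding alpha_moment_vec using D by (intro divide_right_mono) simp_all
  moreover have "recip_binom d i \<le> recip_binom d (r - d)"
    using assms by (intro recip_binom_antimono)
  ultimately show ?thesis
    using alpha_at[of d r m] assms by linarith
qed

section \<open>Optimal parameters\<close>

text \<open>For D > 0 the steps change sign from nonpositive to nonnegative around Q / D, so
  \<open>f\<close> falls and then rises. For D \<le> 0 the factor m D - Q does not increase with m,
  so \<open>f\<close> rises and then falls, and an endpoint is minimal.\<close>

lemma arg_min_if_steps:
  fixes f :: "nat \<Rightarrow> real" and q :: real
  assumes step: "\<And>m. lo \<le> m \<Longrightarrow> m < hi \<Longrightarrow> f (Suc m) - f m = c m * (real m * D - Q)"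
    and c: "\<And>m. lo \<le> m \<Longrightarrow> m < hi \<Longrightarrow> 0 \<le> c m"
  shows "D > 0 \<Longrightarrow> m \<in> {lo..hi} \<Longrightarrow> real m - 1 \<le> Q / D \<Longrightarrow> Q / D \<le> real m \<Longrightarrow>
      is_arg_min f (\<lambda>m. m \<in> {lo..hi}) m"
    and "lo \<le> hi \<Longrightarrow> D \<le> 0 \<Longrightarrow> \<exists>m\<in>{lo, hi}. is_arg_min f (\<lambda>m. m \<in> {lo..hi}) m"
proof -
  have up: "f a \<le> f b" if "lo \<le> a" "a \<le> b" "b \<le> hi" "\<And>k. a \<le> k \<Longrightarrow> k < b \<Longrightarrow> Q \<le> real k * D" for a b
    using that(2,3,4)
  proof (induction b rule: dec_induct)
    case (step k)
    have "0 \<le> f (Suc k) - f k"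
      using assms(1)[of k] c[of k] step that(1) by (simp add: mult_nonneg_nonneg)
    with step show ?case by simp
  qed simp
  have down: "f b \<le> f a" if "lo \<le> a" "a \<le> b" "b \<le> hi" "\<And>k. a \<le> k \<Longrightarrow> k < b \<Longrightarrow> real k * D \<le> Q" for a b
    using that(2,3,4)
  proof (induction b rule: dec_induct)
    case (step k)
    have "f (Suc k) - f k \<le> 0"
      using assms(1)[of k] c[of k] step that(1) by (simp add: mult_nonneg_nonpos)
    with step show ?case by simp
  qed simp
  show "is_arg_min f (\<lambda>m. m \<in> {lo..hi}) m"
    if "D > 0" "m \<in> {lo..hi}" "real m - 1 \<le> Q / D" "Q / D \<le> real m"
  proof -
    have q: "(real m - 1) * D \<le> Q" "Q \<le> real m * D"
      using that by (simp_all add: field_simps)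
    have "f m \<le> f k" if "k \<in> {lo..hi}" for k
    proof (cases "k \<le> m")
      case True
      have "real l * D \<le> Q" if "l < m" for l
      proof -
        have "real l * D \<le> (real m - 1) * D" using that \<open>D > 0\<close> by (intro mult_right_mono) auto
        with q show ?thesis by linarith
      qed
      then show ?thesis using True that \<open>m \<in> _\<close> by (intro down) auto
    next
      case False
      have "Q \<le> real l * D" if "m \<le> l" for l
      proof -
        have "real m * D \<le> real l * D" using that \<open>D > 0\<close> by (intro mult_right_mono) auto
        with q show ?thesis by linarith
      qed
      then show ?thesis using False that \<open>m \<in> _\<close> by (intro up) auto
    qed
    then show ?thesis using that by (auto simp: is_arg_min_linorder)
  qed
  show "\<exists>m\<in>{lo, hi}. is_arg_min f (\<lambda>m. m \<in> {lo..hi}) m" if "lo \<le> hi" "D \<le> 0"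
  proof -
    have "f lo \<le> f k \<or> f hi \<le> f k" if "k \<in> {lo..hi}" for k
    proof (cases "Q \<le> real k * D")
      case True
      have "Q \<le> real l * D" if "l < k" for l
      proof -
        have "real k * D \<le> real l * D" using that \<open>D \<le> 0\<close> by (intro mult_right_mono_neg) auto
        with True show ?thesis by linarith
      qed
      then have "f lo \<le> f k" using that by (intro up) auto
      then show ?thesis ..
    next
      case False
      have "real l * D \<le> Q" if "k \<le> l" for l
      proof -
        have "real l * D \<le> real k * D" using that \<open>D \<le> 0\<close> by (intro mult_right_mono_neg) auto
        with False show ?thesis by linarith
      qed
      then have "f hi \<le> f k" using that by (intro down) auto
      then show ?thesis ..
    qed
    \<comment> \<open>The endpoint that beats \<open>k\<close> may depend on \<open>k\<close>, but
      the smaller of the two endpoint values beats every \<open>k\<close>.\<close>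
    then have "(\<forall>k\<in>{lo..hi}. f lo \<le> f k) \<or> (\<forall>k\<in>{lo..hi}. f hi \<le> f k)"
      by (meson linear order_trans)
    then show ?thesis
      using \<open>lo \<le> hi\<close> by (auto simp: is_arg_min_linorder)
  qed
qed

lemma star_iff: "star r d x m \<longleftrightarrow>
    real m - 1 \<le> star_num r d x / denom r d x \<and> star_num r d x / denom r d x \<le> real m"
  by (simp add: star_def star_num_def Let_def)

lemma alpha_optimal_below:
  assumes "d \<le> r" "r - d \<ge> 2"
  shows "denom r d x > 0 \<Longrightarrow> m \<in> {1..r - d - 1} \<Longrightarrow> star r d x m \<Longrightarrow>
      is_arg_min (\<lambda>m. alpha r d m \<bullet> x) (\<lambda>m. m \<in> {1..r - d - 1}) m"
    and "denom r d x \<le> 0 \<Longrightarrow>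
      \<exists>m\<in>{1, r - d - 1}. is_arg_min (\<lambda>m. alpha r d m \<bullet> x) (\<lambda>m. m \<in> {1..r - d - 1}) m"
proof -
  define c where "c m = 2 / ((real r - real d - real m - 1) * (real r - real d - real m)
    * (real r - real d - real m + 1) * real (r choose d))" for m
  have step: "alpha r d (Suc m) \<bullet> x - alpha r d m \<bullet> x = c m * (real m * denom r d x - star_num r d x)"
    if "1 \<le> m" "m < r - d - 1" for m
    unfolding c_def using that assms by (intro alpha_step) (auto simp: of_nat_diff)
  have c: "0 \<le> c m" if "1 \<le> m" "m < r - d - 1" for m
    unfolding c_def using that assms
    by (intro divide_nonneg_nonneg mult_nonneg_nonneg) (auto simp: of_nat_diff)
  show "denom r d x > 0 \<Longrightarrow> m \<in> {1..r - d - 1} \<Longrightarrow> star r d x m \<Longrightarrow>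
      is_arg_min (\<lambda>m. alpha r d m \<bullet> x) (\<lambda>m. m \<in> {1..r - d - 1}) m"
    using arg_min_if_steps(1)[of 1 "r - d - 1" "\<lambda>m. alpha r d m \<bullet> x" c, OF step c]
    by (simp add: star_iff)
  show "denom r d x \<le> 0 \<Longrightarrow>
      \<exists>m\<in>{1, r - d - 1}. is_arg_min (\<lambda>m. alpha r d m \<bullet> x) (\<lambda>m. m \<in> {1..r - d - 1}) m"
    using arg_min_if_steps(2)[of 1 "r - d - 1" "\<lambda>m. alpha r d m \<bullet> x" c, OF step c] assms
    by simp
qed

text \<open>Beyond \<open>r - d\<close> the step coefficient is nonpositive, so the criterion is applied with both
  the denominator and the numerator of the threshold negated.\<close>

lemma optimal_above:
  assumes "d \<le> r" "n - r \<ge> 2" "v = gamma r d \<or> v = alpha r d"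
  shows "denom r d x < 0 \<Longrightarrow> m \<in> {r - d + 2..n - d} \<Longrightarrow> star r d x m \<Longrightarrow>
      is_arg_min (\<lambda>m. v m \<bullet> x) (\<lambda>m. m \<in> {r - d + 2..n - d}) m"
    and "denom r d x \<ge> 0 \<Longrightarrow>
      \<exists>m\<in>{r - d + 2, n - d}. is_arg_min (\<lambda>m. v m \<bullet> x) (\<lambda>m. m \<in> {r - d + 2..n - d}) m"
proof -
  obtain c where step: "\<And>m. r - d + 2 \<le> m \<Longrightarrow>
      v (Suc m) \<bullet> x - v m \<bullet> x = c m * (real m * denom r d x - star_num r d x)"
    and c: "\<And>m. r - d + 2 \<le> m \<Longrightarrow> c m \<le> 0"
  proof (cases "v = gamma r d")
    case True
    then show ?thesis
      using gamma_step gamma_slope_nonpos assms by (intro that[of "gamma_slope r d"]) auto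
  next
    case False
    then have v: "v = alpha r d" using assms by simp
    show ?thesis
    proof (rule that)
      show "2 / ((real r - real d - real m - 1) * (real r - real d - real m)
          * (real r - real d - real m + 1) * real (r choose d)) \<le> 0" if "r - d + 2 \<le> m" for m
        using that assms
        by (intro divide_nonneg_nonpos mult_nonpos_nonneg mult_nonneg_nonpos mult_nonpos_nonpos)
          (auto simp: of_nat_diff)
      show "v (Suc m) \<bullet> x - v m \<bullet> x = 2 / ((real r - real d - real m - 1) * (real r - real d - real m)
          * (real r - real d - real m + 1) * real (r choose d)) * (real m * denom r d x - star_num r d x)"
        if "r - d + 2 \<le> m" for m
        unfolding v using that assms by (intro alpha_step) (auto simp: of_nat_diff)
    qed
  qed
  have step': "v (Suc m) \<bullet> x - v m \<bullet> x = - c m * (real m * - denom r d x - - star_num r d x)"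
    if "r - d + 2 \<le> m" "m < n - d" for m
    using step[OF that(1)] by (simp add: algebra_simps)
  have c': "0 \<le> - c m" if "r - d + 2 \<le> m" "m < n - d" for m
    using c that by simp
  show "denom r d x < 0 \<Longrightarrow> m \<in> {r - d + 2..n - d} \<Longrightarrow> star r d x m \<Longrightarrow>
      is_arg_min (\<lambda>m. v m \<bullet> x) (\<lambda>m. m \<in> {r - d + 2..n - d}) m"
    using arg_min_if_steps(1)[of "r - d + 2" "n - d" "\<lambda>m. v m \<bullet> x" "\<lambda>m. - c m", OF step' c']
    by (simp add: star_iff)
  show "denom r d x \<ge> 0 \<Longrightarrow>
      \<exists>m\<in>{r - d + 2, n - d}. is_arg_min (\<lambda>m. v m \<bullet> x) (\<lambda>m. m \<in> {r - d + 2..n - d}) m"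
    using arg_min_if_steps(2)[of "r - d + 2" "n - d" "\<lambda>m. v m \<bullet> x" "\<lambda>m. - c m", OF step' c'] assms
    by simp
qed

section \<open>Counting the occurring events\<close>

text \<open>For k \<ge> 1 this is i(i - 1)...(i - k + 2) times d! / (k + d - 1)!, the falling
  factorial of order k - 1 up to a constant.\<close>

definition factorial_moment :: "nat \<Rightarrow> nat \<Rightarrow> nat \<Rightarrow> real" where
  "factorial_moment d k i = real ((i + d) choose (k + d - 1)) / real ((i + d) choose d)"

lemma moment_vec_eq_factorial_moments:
  "moment_vec d (real i) = vector [factorial_moment d 1 i, factorial_moment d 2 i, factorial_moment d 3 i]"
proof -
  have "factorial_moment d 1 i = 1"
    by (simp add: factorial_moment_def)
  moreover have "factorial_moment d 2 i = real i / (real d + 1)"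
    using binomial_Suc_lower[of "i + d" d]
    by (simp add: factorial_moment_def numeral_2_eq_2 add_ac del: binomial_Suc_Suc)
  moreover have "factorial_moment d 3 i = real i * (real i - 1) / ((real d + 1) * (real d + 2))"
  proof (cases i)
    case 0
    then show ?thesis by (simp add: factorial_moment_def)
  next
    case (Suc i')
    have "real (i + d choose Suc (Suc d)) = real (i + d choose d) * (real i * (real i - 1) / ((real d + 1) * (real d + 2)))"
      unfolding binomial_Suc_lower using Suc by (simp add: add_ac mult_ac)
    moreover have "i + d choose (3 + d - 1) = i + d choose Suc (Suc d)"
      by (simp add: numeral_3_eq_3)
    ultimately show ?thesis
      by (simp add: factorial_moment_def)
  qed
  ultimately show ?thesis
    by (simp add: moment_vec_def)
qed

text \<open>Tuples of distinct entries are counted by a falling factorial. This links the tuple sum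
  in \<open>s_comp_cond\<close> with the weights in \<open>s_comp\<close>; if \<open>B\<close> is
  too small, both sides are 0.\<close>

lemma card_distinct_lists_eq_factorial_moment:
  assumes "finite B" "1 \<le> k"
  shows "fact d / fact (k + d - 1) * real (card {u. length u = k - 1 \<and> distinct u \<and> set u \<subseteq> B})
    = factorial_moment d k (card B)"
proof (cases "k - 1 \<le> card B")
  case True
  define b l where "b = card B - (k - 1)" and "l = k - 1"
  have b: "card B = l + b" "k + d - 1 = l + d" "card B - l = b"
    using True assms by (auto simp: b_def l_def)
  have "card {u. length u = l \<and> distinct u \<and> set u \<subseteq> B} = fact (l + b) div fact b"
    using card_lists_distinct_length_eq[OF assms(1), of l] True b
    by (simp add: l_def[symmetric] fact_div_fact)
  then have "real (card {u. length u = l \<and> distinct u \<and> set u \<subseteq> B}) = fact (l + b) / fact b"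
    by (simp add: real_of_nat_div fact_dvd)
  moreover have "real ((l + b + d) choose (l + d)) = fact (l + b + d) / (fact (l + d) * fact b)"
    "real ((l + b + d) choose d) = fact (l + b + d) / (fact d * fact (l + b))"
    by (simp_all add: binomial_fact)
  ultimately show ?thesis
    unfolding factorial_moment_def l_def[symmetric] b by simp
next
  case False
  have "{u. length u = k - 1 \<and> distinct u \<and> set u \<subseteq> B} = {}"
  proof -
    have "length u \<noteq> k - 1" if "distinct u" "set u \<subseteq> B" for u
      using card_mono[OF assms(1) that(2)] distinct_card[OF that(1)] False by simp
    then show ?thesis by blast
  qed
  moreover have "card B + d choose (k + d - 1) = 0"
    using False by (intro binomial_eq_0) simp
  ultimately show ?thesis
    by (simp only: factorial_moment_def card.empty of_nat_0 mult_zero_right div_0)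
qed

section \<open>Counting increasing index tuples\<close>

lemma finite_J: "finite (J n d)"
proof (rule finite_subset)
  show "J n d \<subseteq> {j. set j \<subseteq> {1..n} \<and> length j = d}"
    by (auto simp: J_def)
qed (simp add: finite_lists_length_eq)

lemma card_set_J: "j \<in> J n d \<Longrightarrow> card (set j) = d"
  by (auto simp: J_def strict_sorted_iff distinct_card)

text \<open>A strictly increasing list is determined by its set of entries, so the lists correspond
  to the \<open>d\<close>-element subsets of \<open>S\<close>.\<close>

lemma card_J_subset:
  assumes "S \<subseteq> {1..n}"
  shows "card {j \<in> J n d. set j \<subseteq> S} = card S choose d"
proof -
  have fin: "finite S" using assms finite_subset by blast
  have "bij_betw set {j \<in> J n d. set j \<subseteq> S} {B. B \<subseteq> S \<and> card B = d}"
  proof (rule bij_betw_imageI)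
    show "inj_on set {j \<in> J n d. set j \<subseteq> S}"
      by (auto simp: inj_on_def J_def intro: strict_sorted_equal)
    show "set ` {j \<in> J n d. set j \<subseteq> S} = {B. B \<subseteq> S \<and> card B = d}"
    proof (intro equalityI subsetI)
      fix B assume B: "B \<in> {B. B \<subseteq> S \<and> card B = d}"
      then have "finite B" using fin finite_subset by blast
      then have "sorted_list_of_set B \<in> {j \<in> J n d. set j \<subseteq> S}" "set (sorted_list_of_set B) = B"
        using B assms by (auto simp: J_def)
      then show "B \<in> set ` {j \<in> J n d. set j \<subseteq> S}" by (metis imageI)
    qed (auto simp: card_set_J)
  qed
  then have "card {j \<in> J n d. set j \<subseteq> S} = card {B. B \<subseteq> S \<and> card B = d}"
    by (rule bij_betw_same_card)
  then show ?thesis using n_subsets[OF fin] by simp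
qed

section \<open>Pointwise identities between indicators\<close>

context
  fixes M :: "'a measure" and A :: "nat \<Rightarrow> 'a set" and n :: nat
begin

definition occurring :: "'a \<Rightarrow> nat set" where
  "occurring \<omega> = {k \<in> {1..n}. \<omega> \<in> A k}"

lemma occurring_subset: "occurring \<omega> \<subseteq> {1..n}" and finite_occurring: "finite (occurring \<omega>)"
  and card_occurring_le: "card (occurring \<omega>) \<le> n"
proof -
  show 1: "occurring \<omega> \<subseteq> {1..n}" by (auto simp: occurring_def)
  show "finite (occurring \<omega>)" "card (occurring \<omega>) \<le> n"
    using finite_subset[OF 1] card_mono[OF _ 1] by auto
qed

text \<open>At a given outcome at most one \<open>i\<close> contributes, the number of occurring
  events minus \<open>d\<close>. The subtraction is not truncated when all events in
  \<open>j\<close> occur.\<close>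

lemma sum_exactly_inter:
  fixes c :: "nat \<Rightarrow> real"
  assumes "\<omega> \<in> space M" "j \<in> J n d"
  shows "(\<Sum>i\<le>n - d. c i * indicator (exactly M n A (i + d) \<inter> inter M A j) \<omega>)
    = (if set j \<subseteq> occurring \<omega> then c (card (occurring \<omega>) - d) else 0)"
proof (cases "set j \<subseteq> occurring \<omega>")
  case True
  define i0 where "i0 = card (occurring \<omega>) - d"
  have "d \<le> card (occurring \<omega>)"
    using card_mono[OF finite_occurring True] card_set_J[OF assms(2)] by simp
  then have i0: "card (occurring \<omega>) = i0 + d" "i0 \<le> n - d"
    using card_occurring_le[of \<omega>] by (auto simp: i0_def)
  have "indicator (exactly M n A (i + d) \<inter> inter M A j) \<omega> = (if i = i0 then 1 else 0::real)" for i
    using assms True i0 by (auto simp: exactly_def inter_def occurring_def indicator_def)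
  then have "(\<Sum>i\<le>n - d. c i * indicator (exactly M n A (i + d) \<inter> inter M A j) \<omega>)
      = (\<Sum>i\<le>n - d. if i = i0 then c i else 0)"
    by (intro sum.cong) auto
  then show ?thesis
    using True i0 by simp
next
  case False
  then have "\<omega> \<notin> inter M A j"
    using assms by (auto simp: inter_def occurring_def J_def)
  then show ?thesis using False by simp
qed

text \<open>Double counting: with N occurring events, C(N, d) tuples contribute the same term. If N
  < d the binomial coefficient removes the truncated argument of \<open>c\<close>.\<close>

lemma sum_J_exactly_inter:
  fixes c :: "nat \<Rightarrow> real"
  assumes "\<omega> \<in> space M"
  shows "(\<Sum>(j, i)\<in>J n d \<times> {..n - d}. c i * indicator (exactly M n A (i + d) \<inter> inter M A j) \<omega>)
    = real (card (occurring \<omega>) choose d) * c (card (occurring \<omega>) - d)"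
proof -
  have "(\<Sum>(j, i)\<in>J n d \<times> {..n - d}. c i * indicator (exactly M n A (i + d) \<inter> inter M A j) \<omega>)
    = (\<Sum>j\<in>J n d. if set j \<subseteq> occurring \<omega> then c (card (occurring \<omega>) - d) else 0)"
    using sum_exactly_inter[OF assms] by (simp add: sum.cartesian_product[symmetric])
  also have "\<dots> = (\<Sum>j\<in>{j \<in> J n d. set j \<subseteq> occurring \<omega>}. c (card (occurring \<omega>) - d))"
    by (rule sum.inter_filter[OF finite_J, symmetric])
  finally show ?thesis
    using card_J_subset[OF occurring_subset] by simp
qed

text \<open>The weights cancel the multiplicity C(N, d). Outcomes with N < d occurring events are
  excluded on both sides because d \<le> r.\<close>

lemma indicator_at_least_eq:
  assumes "\<omega> \<in> space M" "d \<le> r"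
  shows "indicator (at_least M n A r) \<omega> = (\<Sum>(j, i)\<in>J n d \<times> {..n - d}.
    (if r - d \<le> i then recip_binom d i else 0) * indicator (exactly M n A (i + d) \<inter> inter M A j) \<omega>)"
proof -
  have "\<omega> \<in> at_least M n A r \<longleftrightarrow> r \<le> card (occurring \<omega>)"
    using assms card_occurring_le[of \<omega>] by (auto simp: at_least_def exactly_def occurring_def)
  then show ?thesis
    unfolding sum_J_exactly_inter[OF assms(1)] using assms
    by (cases "d \<le> card (occurring \<omega>)") (auto simp: recip_binom_def indicator_def binomial_eq_0)
qed

lemma indicator_exactly_eq:
  assumes "\<omega> \<in> space M" "d \<le> r"
  shows "indicator (exactly M n A r) \<omega> = (\<Sum>(j, i)\<in>J n d \<times> {..n - d}.
    (if i = r - d then recip_binom d i else 0) * indicator (exactly M n A (i + d) \<inter> inter M A j) \<omega>)"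
proof -
  have "\<omega> \<in> exactly M n A r \<longleftrightarrow> card (occurring \<omega>) = r"
    using assms by (auto simp: exactly_def occurring_def)
  then show ?thesis
    unfolding sum_J_exactly_inter[OF assms(1)] using assms
    by (cases "d \<le> card (occurring \<omega>)") (auto simp: recip_binom_def indicator_def binomial_eq_0)
qed

text \<open>Pointwise form of the agreement of the two formulas for \<open>s\<close>: only tuples
  \<open>u\<close> of occurring indices outside \<open>j\<close> contribute, and there are card - d
  such indices to draw from.\<close>

lemma sum_inter_append_eq:
  assumes "\<omega> \<in> space M" "j \<in> J n d" "1 \<le> k"
  shows "(\<Sum>u\<in>{u. length u = k - 1 \<and> distinct u \<and> set u \<subseteq> {1..n} - set j}.
      fact d / fact (k + d - 1) * indicator (inter M A (u @ j)) \<omega>)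
    = (\<Sum>i\<le>n - d. factorial_moment d k i * indicator (exactly M n A (i + d) \<inter> inter M A j) \<omega>)"
proof -
  let ?U = "{u. length u = k - 1 \<and> distinct u \<and> set u \<subseteq> {1..n} - set j}"
  let ?V = "{u. length u = k - 1 \<and> distinct u \<and> set u \<subseteq> occurring \<omega> - set j}"
  have fin: "finite ?U"
    by (rule finite_subset[OF _ finite_lists_length_eq[of "{1..n}" "k - 1"]]) auto
  have VU: "?V \<subseteq> ?U" using occurring_subset by auto
  have ind: "indicator (inter M A (u @ j)) \<omega> = (if set j \<subseteq> occurring \<omega> \<and> u \<in> ?V then 1 else 0 :: real)"
    if "u \<in> ?U" for u
    using that assms by (auto simp: inter_def occurring_def indicator_def J_def subset_iff)
  have "(\<Sum>u\<in>?U. fact d / fact (k + d - 1) * indicator (inter M A (u @ j)) \<omega>)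
      = (\<Sum>u\<in>?U. if u \<in> ?V then (if set j \<subseteq> occurring \<omega> then fact d / fact (k + d - 1) else 0) else (0::real))"
    using ind by (intro sum.cong) auto
  also have "\<dots> = (\<Sum>u\<in>?V. if set j \<subseteq> occurring \<omega> then fact d / fact (k + d - 1) else 0)"
    using fin VU by (intro sum.mono_neutral_cong_right) auto
  also have "\<dots> = (if set j \<subseteq> occurring \<omega> then factorial_moment d k (card (occurring \<omega> - set j)) else 0)"
    using card_distinct_lists_eq_factorial_moment[of "occurring \<omega> - set j" k d] finite_occurring assms
    by (simp add: mult_ac)
  also have "\<dots> = (if set j \<subseteq> occurring \<omega> then factorial_moment d k (card (occurring \<omega>) - d) else 0)"
    using card_Diff_subset[of "set j" "occurring \<omega>"] card_set_J[OF assms(2)] by simp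
  finally show ?thesis
    unfolding sum_exactly_inter[OF assms(1,2)] .
qed

end

section \<open>Measurability and passage from indicators to probabilities\<close>

lemma sets_exactly:
  assumes "\<And>i. i \<in> {1..n} \<Longrightarrow> A i \<in> sets M"
  shows "exactly M n A i \<in> sets M"
proof -
  have card: "real (card {k \<in> {1..n}. \<omega> \<in> A k}) = (\<Sum>k\<in>{1..n}. indicator (A k) \<omega>)" for \<omega>
    by (simp add: indicator_def sum.If_cases Int_def)
  then have "exactly M n A i = {\<omega> \<in> space M. (\<Sum>k\<in>{1..n}. indicator (A k) \<omega>) = real i}"
    by (simp only: card[symmetric] of_nat_eq_iff exactly_def)
  moreover have "(\<lambda>\<omega>. \<Sum>k\<in>{1..n}. indicator (A k) \<omega> :: real) \<in> borel_measurable M"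
    using assms by (intro borel_measurable_sum borel_measurable_indicator) auto
  ultimately show ?thesis
    by simp
qed

lemma sets_inter:
  assumes "\<And>i. i \<in> {1..n} \<Longrightarrow> A i \<in> sets M" "set j \<subseteq> {1..n}"
  shows "inter M A j \<in> sets M"
\<comment> \<open>For the empty list the intersection over \<open>set j\<close> is
  \<open>UNIV\<close>, which need not be measurable by itself; only its trace on the space
  is.\<close>
proof (cases "set j = {}")
  case False
  then have "(\<Inter>i\<in>set j. A i) \<in> sets M"
    using assms by (intro sets.finite_INT) auto
  then show ?thesis by (simp add: inter_def)
qed (simp add: inter_def)

lemma measure_eq_sum_if_indicator_eq_sum:
  assumes "finite_measure M" "F \<in> sets M" "\<And>a. a \<in> I \<Longrightarrow> E a \<in> sets M"
    and "\<And>\<omega>. \<omega> \<in> space M \<Longrightarrow> indicator F \<omega> = (\<Sum>a\<in>I. c a * indicator (E a) \<omega> :: real)"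
  shows "measure M F = (\<Sum>a\<in>I. c a * measure M (E a))"
proof -
  interpret finite_measure M by fact
  have int: "integrable M (indicator (E a) :: 'a \<Rightarrow> real)" if "a \<in> I" for a
    using assms(3)[OF that] by (intro integrable_real_indicator) (simp_all add: less_top[symmetric])
  have "measure M F = (\<integral>\<omega>. indicator F \<omega> \<partial>M)"
    using assms(2) by simp
  also have "\<dots> = (\<integral>\<omega>. (\<Sum>a\<in>I. c a * indicator (E a) \<omega>) \<partial>M)"
    using assms(4) by (intro Bochner_Integration.integral_cong) auto
  also have "\<dots> = (\<Sum>a\<in>I. c a * measure M (E a))"
    using assms(3) int by (subst Bochner_Integration.integral_sum) (auto intro!: sum.cong)
  finally show ?thesis .
qed

section \<open>Linearity and positivity of conditional probabilities\<close>

context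
  fixes M G :: "'a measure"
  assumes M: "finite_measure M" and G: "subalgebra M G"
begin

interpretation finite_measure_subalgebra M G
  using M G by (simp add: finite_measure_subalgebra_def finite_measure_subalgebra_axioms_def)

lemma AE_cprob_sum:
  assumes "\<And>a. a \<in> I \<Longrightarrow> E a \<in> sets M"
  shows "AE \<omega> in M. (\<Sum>a\<in>I. c a * cprob M G (E a) \<omega>)
    = real_cond_exp M G (\<lambda>\<omega>. \<Sum>a\<in>I. c a * indicator (E a) \<omega>) \<omega>"
proof (cases "finite I")
  case True
  \<comment> \<open>The empty set outside \<open>I\<close> makes the indicators integrable at every
    index, as the sum rule for conditional expectations asks.\<close>
  define E' where "E' a = (if a \<in> I then E a else {})" for a
  have int: "integrable M (indicator (E' a) :: 'a \<Rightarrow> real)" for a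
    using assms by (intro integrable_real_indicator) (auto simp: E'_def less_top[symmetric])
  have "AE \<omega> in M. \<forall>a\<in>I. real_cond_exp M G (\<lambda>x. c a * indicator (E' a) x) \<omega> = c a * real_cond_exp M G (indicator (E' a)) \<omega>"
    using True int by (intro AE_finite_allI real_cond_exp_cmult) auto
  moreover have "AE \<omega> in M. real_cond_exp M G (\<lambda>x. \<Sum>a\<in>I. c a * indicator (E' a) x) \<omega>
      = (\<Sum>a\<in>I. real_cond_exp M G (\<lambda>x. c a * indicator (E' a) x) \<omega>)"
    using int by (intro real_cond_exp_sum) auto
  ultimately have "AE \<omega> in M. real_cond_exp M G (\<lambda>x. \<Sum>a\<in>I. c a * indicator (E' a) x) \<omega>
      = (\<Sum>a\<in>I. c a * real_cond_exp M G (indicator (E' a)) \<omega>)"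
    by eventually_elim simp
  then show ?thesis
    by (simp add: E'_def cprob_def eq_commute cong: sum.cong)
next
  case False
  have "AE \<omega> in M. real_cond_exp M G (\<lambda>\<omega>. 0) \<omega> = 0"
    by (rule real_cond_exp_F_meas) auto
  then show ?thesis using False by simp
qed

lemma AE_cprob_sum_eq:
  assumes "\<And>a. a \<in> I \<Longrightarrow> E a \<in> sets M" "\<And>b. b \<in> K \<Longrightarrow> F b \<in> sets M"
    and "\<And>\<omega>. \<omega> \<in> space M \<Longrightarrow>
      (\<Sum>a\<in>I. c a * indicator (E a) \<omega>) = (\<Sum>b\<in>K. e b * indicator (F b) \<omega> :: real)"
  shows "AE \<omega> in M. (\<Sum>a\<in>I. c a * cprob M G (E a) \<omega>) = (\<Sum>b\<in>K. e b * cprob M G (F b) \<omega>)"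
proof -
  have "AE \<omega> in M. real_cond_exp M G (\<lambda>\<omega>. \<Sum>a\<in>I. c a * indicator (E a) \<omega>) \<omega>
      = real_cond_exp M G (\<lambda>\<omega>. \<Sum>b\<in>K. e b * indicator (F b) \<omega>) \<omega>"
    using assms by (intro real_cond_exp_cong) auto
  moreover have "AE \<omega> in M. (\<Sum>a\<in>I. c a * cprob M G (E a) \<omega>)
      = real_cond_exp M G (\<lambda>\<omega>. \<Sum>a\<in>I. c a * indicator (E a) \<omega>) \<omega>"
    by (rule AE_cprob_sum) (rule assms)
  moreover have "AE \<omega> in M. (\<Sum>b\<in>K. e b * cprob M G (F b) \<omega>)
      = real_cond_exp M G (\<lambda>\<omega>. \<Sum>b\<in>K. e b * indicator (F b) \<omega>) \<omega>"
    by (rule AE_cprob_sum) (rule assms)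
  ultimately show ?thesis
    by eventually_elim simp
qed

lemma AE_cprob_eq_sum:
  assumes "F \<in> sets M" "\<And>a. a \<in> I \<Longrightarrow> E a \<in> sets M"
    and "\<And>\<omega>. \<omega> \<in> space M \<Longrightarrow> indicator F \<omega> = (\<Sum>a\<in>I. c a * indicator (E a) \<omega> :: real)"
  shows "AE \<omega> in M. cprob M G F \<omega> = (\<Sum>a\<in>I. c a * cprob M G (E a) \<omega>)"
  using AE_cprob_sum_eq[of "{()}" "\<lambda>_. F" I E "\<lambda>_. 1" c] assms by simp

lemma AE_cprob_nonneg:
  assumes "E \<in> sets M"
  shows "AE \<omega> in M. 0 \<le> cprob M G E \<omega>"
  unfolding cprob_def using assms by (intro real_cond_exp_pos) auto

end

section \<open>Bounds\<close>

text \<open>The unconditional and the conditional statement share this form: \<open>y j i\<close> is the (conditional)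
  probability that \<open>A\<^sub>j\<close> and exactly \<open>i + d\<close> of the events occur.\<close>

definition moment_representation ::
  "nat \<Rightarrow> nat \<Rightarrow> nat \<Rightarrow> real \<Rightarrow> real \<Rightarrow> (nat list \<Rightarrow> real ^ 3) \<Rightarrow> bool" where
  "moment_representation n r d P p X \<longleftrightarrow> (\<exists>y.
     (\<forall>j\<in>J n d. \<forall>i\<le>n - d. 0 \<le> y j i) \<and>
     (\<forall>j\<in>J n d. X j = (\<Sum>i\<le>n - d. y j i *\<^sub>R moment_vec d (real i))) \<and>
     P = (\<Sum>j\<in>J n d. \<Sum>i\<le>n - d. (if r - d \<le> i then recip_binom d i else 0) * y j i) \<and>
     p = (\<Sum>j\<in>J n d. \<Sum>i\<le>n - d. (if i = r - d then recip_binom d i else 0) * y j i))"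

text \<open>The predicate \<open>R\<close> is \<open>r - d \<le> i\<close> for the tail probability
  and \<open>i = r - d\<close> for the point probability.\<close>

definition majorizes :: "nat \<Rightarrow> nat \<Rightarrow> (nat \<Rightarrow> bool) \<Rightarrow> real ^ 3 \<Rightarrow> bool" where
  "majorizes n d R v \<longleftrightarrow> (\<forall>i\<le>n - d. (if R i then recip_binom d i else 0) \<le> v \<bullet> moment_vec d (real i))"

text \<open>The majorization is multiplied by the nonnegative masses and summed. As \<open>v\<close>
  may vary with \<open>j\<close>, separate parameters for each \<open>j\<close> and termwise minima
  are covered.\<close>

lemma moment_representation_le:
  assumes "moment_representation n r d P p X"
  shows "(\<And>j. j \<in> J n d \<Longrightarrow> \<exists>v. majorizes n d (\<lambda>i. r - d \<le> i) v \<and> B j = v \<bullet> X j) \<Longrightarrow> P \<le> (\<Sum>j\<in>J n d. B j)"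
    and "(\<And>j. j \<in> J n d \<Longrightarrow> \<exists>v. majorizes n d (\<lambda>i. i = r - d) v \<and> B j = v \<bullet> X j) \<Longrightarrow> p \<le> (\<Sum>j\<in>J n d. B j)"
proof -
  obtain y where y: "\<And>j i. j \<in> J n d \<Longrightarrow> i \<le> n - d \<Longrightarrow> 0 \<le> y j i"
    and X: "\<And>j. j \<in> J n d \<Longrightarrow> X j = (\<Sum>i\<le>n - d. y j i *\<^sub>R moment_vec d (real i))"
    and P: "P = (\<Sum>j\<in>J n d. \<Sum>i\<le>n - d. (if r - d \<le> i then recip_binom d i else 0) * y j i)"
    and p: "p = (\<Sum>j\<in>J n d. \<Sum>i\<le>n - d. (if i = r - d then recip_binom d i else 0) * y j i)"
    using assms unfolding moment_representation_def by blast
  have le: "(\<Sum>j\<in>J n d. \<Sum>i\<le>n - d. (if R i then recip_binom d i else 0) * y j i) \<le> (\<Sum>j\<in>J n d. B j)"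
    if "\<And>j. j \<in> J n d \<Longrightarrow> \<exists>v. majorizes n d R v \<and> B j = v \<bullet> X j" for R :: "nat \<Rightarrow> bool"
  proof (rule sum_mono)
    fix j assume j: "j \<in> J n d"
    then obtain v where v: "majorizes n d R v" "B j = v \<bullet> X j" using \<open>\<And>j. j \<in> J n d \<Longrightarrow> \<exists>v. majorizes n d R v \<and> B j = v \<bullet> X j\<close> by blast
    have "(\<Sum>i\<le>n - d. (if R i then recip_binom d i else 0) * y j i) \<le> (\<Sum>i\<le>n - d. (v \<bullet> moment_vec d (real i)) * y j i)"
      using v(1) y[OF j] unfolding majorizes_def by (intro sum_mono mult_right_mono) auto
    also have "\<dots> = B j"
      unfolding v(2) X[OF j] by (simp add: inner_sum_right mult.commute)
    finally show "(\<Sum>i\<le>n - d. (if R i then recip_binom d i else 0) * y j i) \<le> B j" .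
  qed
  show "(\<And>j. j \<in> J n d \<Longrightarrow> \<exists>v. majorizes n d (\<lambda>i. r - d \<le> i) v \<and> B j = v \<bullet> X j) \<Longrightarrow> P \<le> (\<Sum>j\<in>J n d. B j)"
    unfolding P by (rule le)
  show "(\<And>j. j \<in> J n d \<Longrightarrow> \<exists>v. majorizes n d (\<lambda>i. i = r - d) v \<and> B j = v \<bullet> X j) \<Longrightarrow> p \<le> (\<Sum>j\<in>J n d. B j)"
    unfolding p by (rule le)
qed

lemma majorizes_tail_if:
  assumes "\<And>i. i < r - d \<Longrightarrow> 0 \<le> v \<bullet> moment_vec d (real i)"
    and "\<And>i. r - d \<le> i \<Longrightarrow> i \<le> n - d \<Longrightarrow> recip_binom d i \<le> v \<bullet> moment_vec d (real i)"
  shows "majorizes n d (\<lambda>i. r - d \<le> i) v"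
  using assms by (auto simp: majorizes_def not_le)

lemma majorizes_point_if:
  assumes "\<And>i. i \<le> n - d \<Longrightarrow> 0 \<le> v \<bullet> moment_vec d (real i)"
    and "v \<bullet> moment_vec d (real (r - d)) = recip_binom d (r - d)"
  shows "majorizes n d (\<lambda>i. i = r - d) v"
  unfolding majorizes_def using assms(1) assms(2)[THEN eq_refl[OF sym]] by simp

lemma majorizes_alpha_tail:
  "d \<le> r \<Longrightarrow> m < r - d \<Longrightarrow> majorizes n d (\<lambda>i. r - d \<le> i) (alpha r d m)"
  by (intro majorizes_tail_if alpha_nonneg alpha_ge_recip_binom)

lemma majorizes_alpha_point:
  "d \<le> r \<Longrightarrow> m < r - d \<or> r - d + 2 \<le> m \<Longrightarrow> majorizes n d (\<lambda>i. i = r - d) (alpha r d m)"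
  by (intro majorizes_point_if alpha_nonneg alpha_at)

lemma majorizes_beta: "d < r \<Longrightarrow> r < n \<Longrightarrow> majorizes n d (\<lambda>i. r - d \<le> i) (beta n r d)"
  by (intro majorizes_tail_if beta_nonneg beta_ge_recip_binom)

lemma majorizes_delta: "d < r \<Longrightarrow> r < n \<Longrightarrow> majorizes n d (\<lambda>i. i = r - d) (delta n r d)"
  by (intro majorizes_point_if delta_nonneg delta_eq_recip_binom)

lemma majorizes_gamma:
  "d \<le> r \<Longrightarrow> r - d + 2 \<le> m \<Longrightarrow> majorizes n d (\<lambda>i. r - d \<le> i) (gamma r d m)"
  by (intro majorizes_tail_if gamma_nonneg gamma_ge_recip_binom)

text \<open>The minimum is attained, hence is itself the value of one majorizing vector.\<close>

lemma Min_inner_eq: "finite V \<Longrightarrow> V \<noteq> {} \<Longrightarrow> \<exists>v\<in>V. Min ((\<lambda>v. v \<bullet> x) ` V) = v \<bullet> (x :: real ^ 3)"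
  using Min_in[of "(\<lambda>v. v \<bullet> x) ` V"] by (simp add: image_iff)

text \<open>The quantifier over \<open>m\<close> stands in the conclusion so that, in the
  conditional case, one null set serves all choices of \<open>m\<close>, even those depending on the
  outcome.\<close>

lemma moment_representation_bounds:
  assumes X: "moment_representation n r d P p X" and d: "d \<le> r"
  shows "2 \<le> r - d \<Longrightarrow> \<forall>m. (\<forall>j\<in>J n d. m j \<in> {1..r - d - 1}) \<longrightarrow>
      P \<le> (\<Sum>j\<in>J n d. alpha r d (m j) \<bullet> X j) \<and> p \<le> (\<Sum>j\<in>J n d. alpha r d (m j) \<bullet> X j)"
    and "1 \<le> r - d \<Longrightarrow> 1 \<le> n - r \<Longrightarrow>
      P \<le> (\<Sum>j\<in>J n d. beta n r d \<bullet> X j) \<and> p \<le> (\<Sum>j\<in>J n d. delta n r d \<bullet> X j)"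
    and "2 \<le> n - r \<Longrightarrow> \<forall>m. (\<forall>j\<in>J n d. m j \<in> {r - d + 2..n - d}) \<longrightarrow>
      P \<le> (\<Sum>j\<in>J n d. gamma r d (m j) \<bullet> X j) \<and> p \<le> (\<Sum>j\<in>J n d. alpha r d (m j) \<bullet> X j)"
    and "2 \<le> r - d \<Longrightarrow> 2 \<le> n - r \<Longrightarrow>
      \<forall>m m'. (\<forall>j\<in>J n d. m j \<in> {1..r - d - 1} \<and> m' j \<in> {r - d + 2..n - d}) \<longrightarrow>
      P \<le> (\<Sum>j\<in>J n d. Min {alpha r d (m j) \<bullet> X j, beta n r d \<bullet> X j, gamma r d (m' j) \<bullet> X j})"
    and "2 \<le> r - d \<Longrightarrow> 2 \<le> n - r \<Longrightarrow>
      \<forall>m. (\<forall>j\<in>J n d. m j \<in> {1..r - d - 1} \<union> {r - d + 2..n - d}) \<longrightarrow>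
      p \<le> (\<Sum>j\<in>J n d. Min {alpha r d (m j) \<bullet> X j, delta n r d \<bullet> X j})"
proof -
  note P_le = moment_representation_le(1)[OF X] and p_le = moment_representation_le(2)[OF X]
  show "\<forall>m. (\<forall>j\<in>J n d. m j \<in> {1..r - d - 1}) \<longrightarrow>
      P \<le> (\<Sum>j\<in>J n d. alpha r d (m j) \<bullet> X j) \<and> p \<le> (\<Sum>j\<in>J n d. alpha r d (m j) \<bullet> X j)"
    if "2 \<le> r - d"
  proof (intro allI impI)
    fix m assume "\<forall>j\<in>J n d. m j \<in> {1..r - d - 1}"
    then have m: "m j < r - d" if "j \<in> J n d" for j
      using that \<open>2 \<le> r - d\<close> by fastforce
    show "P \<le> (\<Sum>j\<in>J n d. alpha r d (m j) \<bullet> X j) \<and> p \<le> (\<Sum>j\<in>J n d. alpha r d (m j) \<bullet> X j)"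
      using majorizes_alpha_tail[OF d m] majorizes_alpha_point[OF d disjI1[OF m]]
      by (blast intro: P_le p_le)
  qed
  show "P \<le> (\<Sum>j\<in>J n d. beta n r d \<bullet> X j) \<and> p \<le> (\<Sum>j\<in>J n d. delta n r d \<bullet> X j)"
    if "1 \<le> r - d" "1 \<le> n - r"
  proof -
    have "d < r" "r < n" using that by simp_all
    then show ?thesis
      by (blast intro: P_le p_le majorizes_beta majorizes_delta)
  qed
  show "\<forall>m. (\<forall>j\<in>J n d. m j \<in> {r - d + 2..n - d}) \<longrightarrow>
      P \<le> (\<Sum>j\<in>J n d. gamma r d (m j) \<bullet> X j) \<and> p \<le> (\<Sum>j\<in>J n d. alpha r d (m j) \<bullet> X j)"
    if "2 \<le> n - r"
  proof (intro allI impI)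
    fix m assume "\<forall>j\<in>J n d. m j \<in> {r - d + 2..n - d}"
    then have m: "r - d + 2 \<le> m j" if "j \<in> J n d" for j
      using that by fastforce
    show "P \<le> (\<Sum>j\<in>J n d. gamma r d (m j) \<bullet> X j) \<and> p \<le> (\<Sum>j\<in>J n d. alpha r d (m j) \<bullet> X j)"
      using majorizes_gamma[OF d m] majorizes_alpha_point[OF d disjI2[OF m]]
      by (blast intro: P_le p_le)
  qed
  show "\<forall>m m'. (\<forall>j\<in>J n d. m j \<in> {1..r - d - 1} \<and> m' j \<in> {r - d + 2..n - d}) \<longrightarrow>
      P \<le> (\<Sum>j\<in>J n d. Min {alpha r d (m j) \<bullet> X j, beta n r d \<bullet> X j, gamma r d (m' j) \<bullet> X j})"
    if "2 \<le> r - d" "2 \<le> n - r"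
  proof (intro allI impI P_le)
    fix m m' j assume "\<forall>j\<in>J n d. m j \<in> {1..r - d - 1} \<and> m' j \<in> {r - d + 2..n - d}" "j \<in> J n d"
    then have m: "m j < r - d" "r - d + 2 \<le> m' j" "d < r" "r < n"
      using that by fastforce+
    let ?V = "{alpha r d (m j), beta n r d, gamma r d (m' j)}"
    have "majorizes n d (\<lambda>i. r - d \<le> i) v" if "v \<in> ?V" for v
      using that majorizes_alpha_tail[OF d m(1)] majorizes_beta[OF m(3,4)] majorizes_gamma[OF d m(2)]
      by blast
    then show "\<exists>v. majorizes n d (\<lambda>i. r - d \<le> i) v \<and>
        Min {alpha r d (m j) \<bullet> X j, beta n r d \<bullet> X j, gamma r d (m' j) \<bullet> X j} = v \<bullet> X j"
      using Min_inner_eq[of ?V "X j"] by auto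
  qed
  show "\<forall>m. (\<forall>j\<in>J n d. m j \<in> {1..r - d - 1} \<union> {r - d + 2..n - d}) \<longrightarrow>
      p \<le> (\<Sum>j\<in>J n d. Min {alpha r d (m j) \<bullet> X j, delta n r d \<bullet> X j})"
    if "2 \<le> r - d" "2 \<le> n - r"
  proof (intro allI impI p_le)
    fix m j assume "\<forall>j\<in>J n d. m j \<in> {1..r - d - 1} \<union> {r - d + 2..n - d}" "j \<in> J n d"
    then have m: "m j < r - d \<or> r - d + 2 \<le> m j" "d < r" "r < n"
      using that by fastforce+
    let ?V = "{alpha r d (m j), delta n r d}"
    have "majorizes n d (\<lambda>i. i = r - d) v" if "v \<in> ?V" for v
      using that majorizes_alpha_point[OF d m(1)] majorizes_delta[OF m(2,3)]
      by blast
    then show "\<exists>v. majorizes n d (\<lambda>i. i = r - d) v \<and>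
        Min {alpha r d (m j) \<bullet> X j, delta n r d \<bullet> X j} = v \<bullet> X j"
      using Min_inner_eq[of ?V "X j"] by auto
  qed
qed

section \<open>The representation for probabilities and for conditional probabilities\<close>

lemma moment_representation_prob:
  assumes M: "prob_space M" and A: "\<And>i. i \<in> {1..n} \<Longrightarrow> A i \<in> sets M" and d: "d \<le> r"
  shows "moment_representation n r d (measure M (at_least M n A r)) (measure M (exactly M n A r)) (s M n A d)"
proof -
  interpret prob_space M by fact
  let ?E = "\<lambda>j i. exactly M n A (i + d) \<inter> inter M A j"
  have E: "?E j i \<in> sets M" if "j \<in> J n d" for j i
    using that by (intro sets.Int sets_exactly sets_inter A) (auto simp: J_def)
  have lin: "measure M F = (\<Sum>j\<in>J n d. \<Sum>i\<le>n - d. c i * measure M (?E j i))"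
    if "F \<in> sets M" "\<And>\<omega>. \<omega> \<in> space M \<Longrightarrow>
      indicator F \<omega> = (\<Sum>(j, i)\<in>J n d \<times> {..n - d}. c i * indicator (?E j i) \<omega>)" for F c
    using measure_eq_sum_if_indicator_eq_sum[of M F "J n d \<times> {..n - d}" "\<lambda>(j, i). ?E j i" "\<lambda>(j, i). c i"]
      that E finite_measure_axioms by (simp add: split_def sum.cartesian_product mem_Times_iff)
  \<comment> \<open>The sum in \<open>s_comp\<close> starts at 1, so its index is one larger than
    the \<open>i\<close> used here.\<close>
  have s_comp: "s_comp M n A d k j = (\<Sum>i\<le>n - d. factorial_moment d k i * measure M (?E j i))" for k j
    unfolding s_comp_def
    by (rule sum.reindex_bij_witness[of _ Suc "\<lambda>i. i - 1"]) (auto simp: factorial_moment_def)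
  have "s M n A d j = (\<Sum>i\<le>n - d. measure M (?E j i) *\<^sub>R moment_vec d (real i))" for j
    unfolding s_def s_comp moment_vec_eq_factorial_moments
    by (simp add: vec_eq_iff forall_3 mult.commute)
  moreover have "at_least M n A r \<in> sets M" "exactly M n A r \<in> sets M"
    unfolding at_least_def using sets_exactly A by (auto intro!: sets.finite_UN)
  then have "measure M (at_least M n A r)
      = (\<Sum>j\<in>J n d. \<Sum>i\<le>n - d. (if r - d \<le> i then recip_binom d i else 0) * measure M (?E j i))"
    "measure M (exactly M n A r)
      = (\<Sum>j\<in>J n d. \<Sum>i\<le>n - d. (if i = r - d then recip_binom d i else 0) * measure M (?E j i))"
    using indicator_at_least_eq[OF _ d] indicator_exactly_eq[OF _ d] by (auto intro!: lin)
  ultimately show ?thesis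
    unfolding moment_representation_def by (intro exI[of _ "\<lambda>j i. measure M (?E j i)"]) auto
qed

text \<open>Each identity holds outside a null set; only finitely many pairs (j, i) and three orders
  k occur, so one null set suffices for all.\<close>

lemma AE_moment_representation_cond:
  assumes M: "prob_space M" and A: "\<And>i. i \<in> {1..n} \<Longrightarrow> A i \<in> sets M" and d: "d \<le> r"
    and G: "subalgebra M G"
  shows "AE \<omega> in M. moment_representation n r d (cprob M G (at_least M n A r) \<omega>)
    (cprob M G (exactly M n A r) \<omega>) (\<lambda>j. s_cond M G n A d j \<omega>)"
proof -
  interpret prob_space M by fact
  note MG = finite_measure_axioms G
  let ?E = "\<lambda>j i. exactly M n A (i + d) \<inter> inter M A j"
  have E: "?E j i \<in> sets M" if "j \<in> J n d" for j i
    using that by (intro sets.Int sets_exactly sets_inter A) (auto simp: J_def)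
  have lin: "AE \<omega> in M. cprob M G F \<omega> = (\<Sum>j\<in>J n d. \<Sum>i\<le>n - d. c i * cprob M G (?E j i) \<omega>)"
    if "F \<in> sets M" "\<And>\<omega>. \<omega> \<in> space M \<Longrightarrow>
      indicator F \<omega> = (\<Sum>(j, i)\<in>J n d \<times> {..n - d}. c i * indicator (?E j i) \<omega>)" for F c
    using AE_cprob_eq_sum[OF MG, of F "J n d \<times> {..n - d}" "\<lambda>(j, i). ?E j i" "\<lambda>(j, i). c i"]
      that E by (simp add: split_def sum.cartesian_product mem_Times_iff)
  have s_comp: "AE \<omega> in M. \<forall>j\<in>J n d. s_comp_cond M G n A d k j \<omega>
      = (\<Sum>i\<le>n - d. factorial_moment d k i * cprob M G (?E j i) \<omega>)" if "1 \<le> k" for k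
  proof (rule AE_finite_allI[OF finite_J])
    fix j assume j: "j \<in> J n d"
    show "AE \<omega> in M. s_comp_cond M G n A d k j \<omega>
      = (\<Sum>i\<le>n - d. factorial_moment d k i * cprob M G (?E j i) \<omega>)"
      unfolding s_comp_cond_def sum_distrib_left
    proof (rule AE_cprob_sum_eq[OF MG])
      show "inter M A (u @ j) \<in> sets M"
        if "u \<in> {u. length u = k - 1 \<and> distinct u \<and> set u \<subseteq> {1..n} - set j}" for u
        using that j by (intro sets_inter A) (auto simp: J_def)
    qed (use E[OF j] sum_inter_append_eq[OF _ j that] in auto)
  qed
  have sets: "at_least M n A r \<in> sets M" "exactly M n A r \<in> sets M"
    unfolding at_least_def using sets_exactly A by (auto intro!: sets.finite_UN)
  have "AE \<omega> in M. \<forall>j\<in>J n d. \<forall>i\<in>{..n - d}. 0 \<le> cprob M G (?E j i) \<omega>"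
    by (intro AE_finite_allI finite_J finite_atMost AE_cprob_nonneg[OF MG] E)
  moreover have "AE \<omega> in M. cprob M G (at_least M n A r) \<omega>
      = (\<Sum>j\<in>J n d. \<Sum>i\<le>n - d. (if r - d \<le> i then recip_binom d i else 0) * cprob M G (?E j i) \<omega>)"
    using indicator_at_least_eq[OF _ d] by (intro lin sets) auto
  moreover have "AE \<omega> in M. cprob M G (exactly M n A r) \<omega>
      = (\<Sum>j\<in>J n d. \<Sum>i\<le>n - d. (if i = r - d then recip_binom d i else 0) * cprob M G (?E j i) \<omega>)"
    using indicator_exactly_eq[OF _ d] by (intro lin sets) auto
  ultimately show ?thesis
    using s_comp[of 1, OF order_refl] s_comp[of 2, OF one_le_numeral] s_comp[of 3, OF one_le_numeral]
  proof eventually_elim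
    case (elim \<omega>)
    have "s_cond M G n A d j \<omega> = (\<Sum>i\<le>n - d. cprob M G (?E j i) \<omega> *\<^sub>R moment_vec d (real i))"
      if "j \<in> J n d" for j
      unfolding s_cond_def moment_vec_eq_factorial_moments
      using elim(4-6) that by (simp add: vec_eq_iff forall_3 mult.commute)
    with elim show ?case
      unfolding moment_representation_def by (intro exI[of _ "\<lambda>j i. cprob M G (?E j i) \<omega>"]) auto
  qed
qed

text \<open>The least minimizer is selected by countably many comparisons of measurable functions.
  It exists at every outcome because the range is finite and nonempty.\<close>

lemma measurable_arg_min:
  fixes f :: "nat \<Rightarrow> 'a \<Rightarrow> real"
  assumes "\<And>m. f m \<in> borel_measurable G" "lo \<le> hi"
  shows "\<exists>m \<in> measurable G (count_space UNIV).
    \<forall>\<omega>. is_arg_min (\<lambda>m. f m \<omega>) (\<lambda>m. m \<in> {lo..hi}) (m \<omega>)"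
proof
  let ?Q = "\<lambda>\<omega> m. m \<in> {lo..hi} \<and> (\<forall>k\<in>{lo..hi}. f m \<omega> \<le> f k \<omega>)"
  show "(\<lambda>\<omega>. LEAST m. ?Q \<omega> m) \<in> measurable G (count_space UNIV)"
    using assms(1)[measurable] by measurable
  show "\<forall>\<omega>. is_arg_min (\<lambda>m. f m \<omega>) (\<lambda>m. m \<in> {lo..hi}) (LEAST m. ?Q \<omega> m)"
  proof
    fix \<omega>
    have "\<exists>m. is_arg_min (\<lambda>m. f m \<omega>) (\<lambda>m. m \<in> {lo..hi}) m"
      using ex_is_arg_min_if_finite[of "{lo..hi}" "\<lambda>m. f m \<omega>"] assms(2) by auto
    then have "\<exists>m. ?Q \<omega> m"
      by (auto simp: is_arg_min_linorder)
    then have "?Q \<omega> (LEAST m. ?Q \<omega> m)"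
      by (rule LeastI_ex)
    then show "is_arg_min (\<lambda>m. f m \<omega>) (\<lambda>m. m \<in> {lo..hi}) (LEAST m. ?Q \<omega> m)"
      by (auto simp: is_arg_min_linorder)
  qed
qed

lemma measurable_inner_s_cond: "(\<lambda>\<omega>. v \<bullet> s_cond M G n A d j \<omega>) \<in> borel_measurable G"
  unfolding inner_vec3 s_cond_def vector_3 s_comp_cond_def cprob_def by measurable

theorem theorem3:
  fixes M :: "'a measure" and A :: "nat \<Rightarrow> 'a set" and n r d :: nat
  assumes "prob_space M"
    and "\<And>i. i \<in> {1..n} \<Longrightarrow> A i \<in> sets M"
    and "1 \<le> r" and "r \<le> n" and "d \<le> r"
  shows
    \<comment> \<open>(i)\<close>
    "(r - d \<ge> 2 \<longrightarrow>
       (\<forall>m. (\<forall>j\<in>J n d. m j \<in> {1..r - d - 1}) \<longrightarrow>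
          measure M (at_least M n A r) \<le> (\<Sum>j\<in>J n d. alpha r d (m j) \<bullet> s M n A d j) \<and>
          measure M (exactly M n A r) \<le> (\<Sum>j\<in>J n d. alpha r d (m j) \<bullet> s M n A d j)) \<and>
       (\<forall>j\<in>J n d.
          (denom r d (s M n A d j) > 0 \<longrightarrow>
             (\<forall>m\<in>{1..r - d - 1}. star r d (s M n A d j) m \<longrightarrow>
                is_arg_min (\<lambda>m. alpha r d m \<bullet> s M n A d j) (\<lambda>m. m \<in> {1..r - d - 1}) m)) \<and>
          (denom r d (s M n A d j) \<le> 0 \<longrightarrow>
             (\<exists>m\<in>{1, r - d - 1}.
                is_arg_min (\<lambda>m. alpha r d m \<bullet> s M n A d j) (\<lambda>m. m \<in> {1..r - d - 1}) m)))) \<and>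

     \<comment> \<open>(ii)\<close>
     (r - d \<ge> 1 \<and> n - r \<ge> 1 \<longrightarrow>
       measure M (at_least M n A r) \<le> (\<Sum>j\<in>J n d. beta n r d \<bullet> s M n A d j) \<and>
       measure M (exactly M n A r) \<le> (\<Sum>j\<in>J n d. delta n r d \<bullet> s M n A d j)) \<and>

     \<comment> \<open>(iii)\<close>
     (n - r \<ge> 2 \<longrightarrow>
       (\<forall>m. (\<forall>j\<in>J n d. m j \<in> {r - d + 2..n - d}) \<longrightarrow>
          measure M (at_least M n A r) \<le> (\<Sum>j\<in>J n d. gamma r d (m j) \<bullet> s M n A d j) \<and>
          measure M (exactly M n A r) \<le> (\<Sum>j\<in>J n d. alpha r d (m j) \<bullet> s M n A d j)) \<and>
       (\<forall>j\<in>J n d. \<forall>v\<in>{gamma r d, alpha r d}.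
          (denom r d (s M n A d j) < 0 \<longrightarrow>
             (\<forall>m\<in>{r - d + 2..n - d}. star r d (s M n A d j) m \<longrightarrow>
                is_arg_min (\<lambda>m. v m \<bullet> s M n A d j) (\<lambda>m. m \<in> {r - d + 2..n - d}) m)) \<and>
          (denom r d (s M n A d j) \<ge> 0 \<longrightarrow>
             (\<exists>m\<in>{r - d + 2, n - d}.
                is_arg_min (\<lambda>m. v m \<bullet> s M n A d j) (\<lambda>m. m \<in> {r - d + 2..n - d}) m)))) \<and>

     \<comment> \<open>(iv)\<close>
     (r - d \<ge> 2 \<and> n - r \<ge> 2 \<longrightarrow>
       (\<forall>m m'. (\<forall>j\<in>J n d. m j \<in> {1..r - d - 1} \<and> m' j \<in> {r - d + 2..n - d}) \<longrightarrow>
          measure M (at_least M n A r) \<le>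
            (\<Sum>j\<in>J n d. Min {alpha r d (m j) \<bullet> s M n A d j, beta n r d \<bullet> s M n A d j,
                               gamma r d (m' j) \<bullet> s M n A d j})) \<and>
       (\<forall>m. (\<forall>j\<in>J n d. m j \<in> {1..r - d - 1} \<union> {r - d + 2..n - d}) \<longrightarrow>
          measure M (exactly M n A r) \<le>
            (\<Sum>j\<in>J n d. Min {alpha r d (m j) \<bullet> s M n A d j, delta n r d \<bullet> s M n A d j}))) \<and>

     \<comment> \<open>(v)\<close>
     (\<forall>G. subalgebra M G \<longrightarrow>
       \<comment> \<open>(i) given \<open>G\<close>\<close>
       (r - d \<ge> 2 \<longrightarrow>
         (AE \<omega> in M.
           (\<forall>m. (\<forall>j\<in>J n d. m j \<in> {1..r - d - 1}) \<longrightarrow>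
              cprob M G (at_least M n A r) \<omega> \<le>
                (\<Sum>j\<in>J n d. alpha r d (m j) \<bullet> s_cond M G n A d j \<omega>) \<and>
              cprob M G (exactly M n A r) \<omega> \<le>
                (\<Sum>j\<in>J n d. alpha r d (m j) \<bullet> s_cond M G n A d j \<omega>)) \<and>
           (\<forall>j\<in>J n d.
              (denom r d (s_cond M G n A d j \<omega>) > 0 \<longrightarrow>
                 (\<forall>m\<in>{1..r - d - 1}. star r d (s_cond M G n A d j \<omega>) m \<longrightarrow>
                    is_arg_min (\<lambda>m. alpha r d m \<bullet> s_cond M G n A d j \<omega>)
                      (\<lambda>m. m \<in> {1..r - d - 1}) m)) \<and>
              (denom r d (s_cond M G n A d j \<omega>) \<le> 0 \<longrightarrow>
                 (\<exists>m\<in>{1, r - d - 1}.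
                    is_arg_min (\<lambda>m. alpha r d m \<bullet> s_cond M G n A d j \<omega>)
                      (\<lambda>m. m \<in> {1..r - d - 1}) m)))) \<and>
         (\<forall>j\<in>J n d. \<exists>m \<in> measurable G (count_space UNIV). \<forall>\<omega>\<in>space M.
            is_arg_min (\<lambda>m. alpha r d m \<bullet> s_cond M G n A d j \<omega>)
              (\<lambda>m. m \<in> {1..r - d - 1}) (m \<omega>))) \<and>

       \<comment> \<open>(ii) given \<open>G\<close>\<close>
       (r - d \<ge> 1 \<and> n - r \<ge> 1 \<longrightarrow>
         (AE \<omega> in M.
            cprob M G (at_least M n A r) \<omega> \<le> (\<Sum>j\<in>J n d. beta n r d \<bullet> s_cond M G n A d j \<omega>) \<and>
            cprob M G (exactly M n A r) \<omega> \<le> (\<Sum>j\<in>J n d. delta n r d \<bullet> s_cond M G n A d j \<omega>))) \<and>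

       \<comment> \<open>(iii) given \<open>G\<close>\<close>
       (n - r \<ge> 2 \<longrightarrow>
         (AE \<omega> in M.
           (\<forall>m. (\<forall>j\<in>J n d. m j \<in> {r - d + 2..n - d}) \<longrightarrow>
              cprob M G (at_least M n A r) \<omega> \<le>
                (\<Sum>j\<in>J n d. gamma r d (m j) \<bullet> s_cond M G n A d j \<omega>) \<and>
              cprob M G (exactly M n A r) \<omega> \<le>
                (\<Sum>j\<in>J n d. alpha r d (m j) \<bullet> s_cond M G n A d j \<omega>)) \<and>
           (\<forall>j\<in>J n d. \<forall>v\<in>{gamma r d, alpha r d}.
              (denom r d (s_cond M G n A d j \<omega>) < 0 \<longrightarrow>
                 (\<forall>m\<in>{r - d + 2..n - d}. star r d (s_cond M G n A d j \<omega>) m \<longrightarrow>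
                    is_arg_min (\<lambda>m. v m \<bullet> s_cond M G n A d j \<omega>)
                      (\<lambda>m. m \<in> {r - d + 2..n - d}) m)) \<and>
              (denom r d (s_cond M G n A d j \<omega>) \<ge> 0 \<longrightarrow>
                 (\<exists>m\<in>{r - d + 2, n - d}.
                    is_arg_min (\<lambda>m. v m \<bullet> s_cond M G n A d j \<omega>)
                      (\<lambda>m. m \<in> {r - d + 2..n - d}) m)))) \<and>
         (\<forall>j\<in>J n d. \<forall>v\<in>{gamma r d, alpha r d}.
            \<exists>m \<in> measurable G (count_space UNIV). \<forall>\<omega>\<in>space M.
              is_arg_min (\<lambda>m. v m \<bullet> s_cond M G n A d j \<omega>)
                (\<lambda>m. m \<in> {r - d + 2..n - d}) (m \<omega>))) \<and>

       \<comment> \<open>(iv) given \<open>G\<close>\<close>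
       (r - d \<ge> 2 \<and> n - r \<ge> 2 \<longrightarrow>
         (AE \<omega> in M.
           (\<forall>m m'. (\<forall>j\<in>J n d. m j \<in> {1..r - d - 1} \<and> m' j \<in> {r - d + 2..n - d}) \<longrightarrow>
              cprob M G (at_least M n A r) \<omega> \<le>
                (\<Sum>j\<in>J n d. Min {alpha r d (m j) \<bullet> s_cond M G n A d j \<omega>,
                                   beta n r d \<bullet> s_cond M G n A d j \<omega>,
                                   gamma r d (m' j) \<bullet> s_cond M G n A d j \<omega>})) \<and>
           (\<forall>m. (\<forall>j\<in>J n d. m j \<in> {1..r - d - 1} \<union> {r - d + 2..n - d}) \<longrightarrow>
              cprob M G (exactly M n A r) \<omega> \<le>
                (\<Sum>j\<in>J n d. Min {alpha r d (m j) \<bullet> s_cond M G n A d j \<omega>,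
                                   delta n r d \<bullet> s_cond M G n A d j \<omega>})))))"
proof -
  interpret prob_space M by fact
  note d = \<open>d \<le> r\<close>
  \<comment> \<open>Optimality concerns arbitrary vectors \<open>X j\<close>, so it applies to
    \<open>s\<close> and to each value of \<open>s_cond\<close> alike.\<close>
  have opt_i: "\<forall>j\<in>J n d.
      (denom r d (X j) > 0 \<longrightarrow> (\<forall>m\<in>{1..r - d - 1}. star r d (X j) m \<longrightarrow>
        is_arg_min (\<lambda>m. alpha r d m \<bullet> X j) (\<lambda>m. m \<in> {1..r - d - 1}) m)) \<and>
      (denom r d (X j) \<le> 0 \<longrightarrow> (\<exists>m\<in>{1, r - d - 1}.
        is_arg_min (\<lambda>m. alpha r d m \<bullet> X j) (\<lambda>m. m \<in> {1..r - d - 1}) m))"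
    if "2 \<le> r - d" for X
    using alpha_optimal_below[OF d that] by blast
  have opt_iii: "\<forall>j\<in>J n d. \<forall>v\<in>{gamma r d, alpha r d}.
      (denom r d (X j) < 0 \<longrightarrow> (\<forall>m\<in>{r - d + 2..n - d}. star r d (X j) m \<longrightarrow>
        is_arg_min (\<lambda>m. v m \<bullet> X j) (\<lambda>m. m \<in> {r - d + 2..n - d}) m)) \<and>
      (denom r d (X j) \<ge> 0 \<longrightarrow> (\<exists>m\<in>{r - d + 2, n - d}.
        is_arg_min (\<lambda>m. v m \<bullet> X j) (\<lambda>m. m \<in> {r - d + 2..n - d}) m))"
    if "2 \<le> n - r" for X
    using optimal_above[OF d that] by blast
  have "moment_representation n r d (measure M (at_least M n A r)) (measure M (exactly M n A r)) (s M n A d)"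
    by (rule moment_representation_prob) (use assms in auto)
  note bounds = moment_representation_bounds[OF this d]
  have meas: "\<exists>m \<in> measurable G (count_space UNIV). \<forall>\<omega>\<in>space M.
      is_arg_min (\<lambda>m. v m \<bullet> s_cond M G n A d j \<omega>) (\<lambda>m. m \<in> {lo..hi}) (m \<omega>)"
    if "lo \<le> hi" for G v j and lo hi :: nat
    using measurable_arg_min[of "\<lambda>m \<omega>. v m \<bullet> s_cond M G n A d j \<omega>", OF measurable_inner_s_cond that]
    by blast
  have rep: "AE \<omega> in M. moment_representation n r d (cprob M G (at_least M n A r) \<omega>)
      (cprob M G (exactly M n A r) \<omega>) (\<lambda>j. s_cond M G n A d j \<omega>)"
    if "subalgebra M G" for G
    by (rule AE_moment_representation_cond) (use assms that in auto)
  show ?thesis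
    apply (intro conjI impI)
    subgoal by (rule bounds(1))
    subgoal by (rule opt_i)
    subgoal using bounds(2) by blast
    subgoal using bounds(2) by blast
    subgoal by (rule bounds(3))
    subgoal by (rule opt_iii)
    subgoal by (elim conjE) (rule bounds(4))
    subgoal by (elim conjE) (rule bounds(5))
    apply (intro allI impI)
    apply (intro conjI impI)
    subgoal
      by (rule eventually_mono, erule rep, rule conjI,
          erule moment_representation_bounds(1)[OF _ d], assumption, erule opt_i)
    subgoal by (intro ballI meas) simp
    subgoal
      by (elim conjE, rule eventually_mono, erule rep, erule moment_representation_bounds(2)[OF _ d])
    subgoal
      by (rule eventually_mono, erule rep, rule conjI,
          erule moment_representation_bounds(3)[OF _ d], assumption, erule opt_iii)
    subgoal using d by (intro ballI meas) simp
    subgoal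
      by (elim conjE, rule eventually_mono, erule rep, rule conjI,
          erule moment_representation_bounds(4)[OF _ d], assumption, assumption,
          erule moment_representation_bounds(5)[OF _ d])
    done
qed

end
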